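(* Let $A$ be a unitarizable Hopf $*$-algebra and $Z$ an $A$-$*$-Galois extension with a positive Haar measure. Then $Z$ admits a $C^*$-norm. Moreover, the supremum of all $C^*$-seminorms on $Z$ is finite at every element and is a $C^*$-norm on $Z$.
   Context: Base field $\mathbb C$. A Hopf $*$-algebra is a Hopf algebra that is a $*$-algebra with $\Delta$ a $*$-homomorphism; unitarizable means every finite-dimensional right comodule $V$ admits a scalar product $\phi_V:\overline V\otimes V\to\mathbb C$ that is a comodule map ($\overline V$ the conjugate comodule, $\overline v\mapsto\sum\overline{v_i}\otimes a_i^*$ if $\alpha_V(v)=\sum v_i\otimes a_i$). An $A$-$*$-Galois extension is a nonzero $*$-algebra $Z$ with a left coaction $\alpha_Z:Z\to A\otimes Z$ that is a $*$-homomorphism and with $(1_A\otimes m_Z)(\alpha_Z\otimes 1_Z):Z\otimes Z\to A\otimes Z$ bijective. A Haar measure on $Z$: linear $\mu$ with $(1_A\otimes\mu)\alpha_Z=\mu(\cdot)1_A$, $\mu(1)=1$; positive if $\mu(z^*z)\ge0$. A $C^*$-seminorm on a $*$-algebra is a submultiplicative seminorm $p$ with $p(x^*x)=p(x)^2$. *)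

theory Defs
  imports "HOL-Analysis.Analysis" "HOL-Library.Function_Algebras"
begin

class cvec = ab_group_add +
  fixes scaleC :: "complex \<Rightarrow> 'a \<Rightarrow> 'a" (infixr "*\<^sub>C" 75)
  assumes scaleC_add_right: "c *\<^sub>C (x + y) = c *\<^sub>C x + c *\<^sub>C y"
    and scaleC_add_left: "(b + c) *\<^sub>C x = b *\<^sub>C x + c *\<^sub>C x"
    and scaleC_scaleC: "b *\<^sub>C (c *\<^sub>C x) = (b * c) *\<^sub>C x"
    and scaleC_one: "1 *\<^sub>C x = x"

class calg = cvec + ring_1 +
  assumes mult_scaleC_left: "(c *\<^sub>C x) * y = c *\<^sub>C (x * y)"
    and mult_scaleC_right: "x * (c *\<^sub>C y) = c *\<^sub>C (x * y)"

class star_alg = calg +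
  fixes star :: "'a \<Rightarrow> 'a"
  assumes star_star: "star (star x) = x"
    and star_add: "star (x + y) = star x + star y"
    and star_scaleC: "star (c *\<^sub>C x) = cnj c *\<^sub>C star x"
    and star_mult: "star (x * y) = star y * star x"

instantiation complex :: cvec
begin
definition scaleC_complex :: "complex \<Rightarrow> complex \<Rightarrow> complex" where
  "scaleC_complex c x = c * x"
instance by standard (auto simp: scaleC_complex_def algebra_simps)
end

instantiation "fun" :: (type, cvec) cvec
begin
definition scaleC_fun :: "complex \<Rightarrow> ('a \<Rightarrow> 'b) \<Rightarrow> 'a \<Rightarrow> 'b" where
  "scaleC_fun c f = (\<lambda>i. c *\<^sub>C f i)"
instance by standard
  (auto simp: scaleC_fun_def plus_fun_def scaleC_add_right scaleC_add_left scaleC_scaleC scaleC_one)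
end

definition clinear_fun :: "('v::cvec \<Rightarrow> complex) \<Rightarrow> bool" where
  "clinear_fun f \<longleftrightarrow> (\<forall>x y. f (x + y) = f x + f y) \<and> (\<forall>c x. f (c *\<^sub>C x) = c * f x)"

text \<open>A list of pairs [(v1,w1),...] represents the tensor \<Sum> vi \<otimes> wi in the
algebraic tensor product over \<complex>.  Two such lists represent the same tensor iff they
agree against all products of linear functionals (this separates points of V \<otimes> W).\<close>

definition teq :: "('v::cvec \<times> 'w::cvec) list \<Rightarrow> ('v \<times> 'w) list \<Rightarrow> bool" where
  "teq xs ys \<longleftrightarrow> (\<forall>f g. clinear_fun f \<longrightarrow> clinear_fun g \<longrightarrow>
      (\<Sum>(v, w)\<leftarrow>xs. f v * g w) = (\<Sum>(v, w)\<leftarrow>ys. f v * g w))"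

definition teq3 :: "('u::cvec \<times> 'v::cvec \<times> 'w::cvec) list \<Rightarrow> ('u \<times> 'v \<times> 'w) list \<Rightarrow> bool" where
  "teq3 xs ys \<longleftrightarrow> (\<forall>f g h. clinear_fun f \<longrightarrow> clinear_fun g \<longrightarrow> clinear_fun h \<longrightarrow>
      (\<Sum>(u, v, w)\<leftarrow>xs. f u * g v * h w) = (\<Sum>(u, v, w)\<leftarrow>ys. f u * g v * h w))"

definition tmul :: "('a::times \<times> 'b::times) list \<Rightarrow> ('a \<times> 'b) list \<Rightarrow> ('a \<times> 'b) list" where
  "tmul xs ys = [(a * a', b * b'). (a, b) \<leftarrow> xs, (a', b') \<leftarrow> ys]"

definition tensor_star_hom :: "('z::star_alg \<Rightarrow> ('a::star_alg \<times> 'b::star_alg) list) \<Rightarrow> bool" where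
  "tensor_star_hom F \<longleftrightarrow>
     (\<forall>x y. teq (F (x + y)) (F x @ F y)) \<and>
     (\<forall>c x. teq (F (c *\<^sub>C x)) (map (\<lambda>(a, b). (c *\<^sub>C a, b)) (F x))) \<and>
     (\<forall>x y. teq (F (x * y)) (tmul (F x) (F y))) \<and>
     teq (F 1) [(1, 1)] \<and>
     (\<forall>x. teq (F (star x)) (map (\<lambda>(a, b). (star a, star b)) (F x)))"

definition hopf_star_algebra ::
  "('a::star_alg \<Rightarrow> ('a \<times> 'a) list) \<Rightarrow> ('a \<Rightarrow> complex) \<Rightarrow> ('a \<Rightarrow> 'a) \<Rightarrow> bool" where
  "hopf_star_algebra \<Delta> \<epsilon> S \<longleftrightarrow>
     tensor_star_hom \<Delta> \<and>
     (\<forall>x. teq3 (concat [map (\<lambda>(p, q). (p, q, v)) (\<Delta> u). (u, v) \<leftarrow> \<Delta> x])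
                (concat [map (\<lambda>(p, q). (u, p, q)) (\<Delta> v). (u, v) \<leftarrow> \<Delta> x])) \<and>
     clinear_fun \<epsilon> \<and> (\<forall>x y. \<epsilon> (x * y) = \<epsilon> x * \<epsilon> y) \<and> \<epsilon> 1 = 1 \<and>
     (\<forall>x. (\<Sum>(u, v)\<leftarrow>\<Delta> x. \<epsilon> u *\<^sub>C v) = x) \<and>
     (\<forall>x. (\<Sum>(u, v)\<leftarrow>\<Delta> x. \<epsilon> v *\<^sub>C u) = x) \<and>
     (\<forall>x y. S (x + y) = S x + S y) \<and> (\<forall>c x. S (c *\<^sub>C x) = c *\<^sub>C S x) \<and>
     (\<forall>x. (\<Sum>(u, v)\<leftarrow>\<Delta> x. S u * v) = \<epsilon> x *\<^sub>C 1) \<and>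
     (\<forall>x. (\<Sum>(u, v)\<leftarrow>\<Delta> x. u * S v) = \<epsilon> x *\<^sub>C 1)"

text \<open>Every finite-dimensional comodule is isomorphic to one whose underlying space is
  \<complex>^n, realised as cspace n = {v :: nat \<Rightarrow> complex. v vanishes outside {..<n}}.\<close>
definition cspace :: "nat \<Rightarrow> (nat \<Rightarrow> complex) set" where
  "cspace n = {v. \<forall>i\<ge>n. v i = 0}"

definition right_comodule ::
  "('a::star_alg \<Rightarrow> ('a \<times> 'a) list) \<Rightarrow> ('a \<Rightarrow> complex) \<Rightarrow> nat
     \<Rightarrow> ((nat \<Rightarrow> complex) \<Rightarrow> ((nat \<Rightarrow> complex) \<times> 'a) list) \<Rightarrow> bool" where
  "right_comodule \<Delta> \<epsilon> n \<alpha> \<longleftrightarrow>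
     (\<forall>v\<in>cspace n. fst ` set (\<alpha> v) \<subseteq> cspace n) \<and>
     (\<forall>v\<in>cspace n. \<forall>w\<in>cspace n. teq (\<alpha> (v + w)) (\<alpha> v @ \<alpha> w)) \<and>
     (\<forall>c. \<forall>v\<in>cspace n. teq (\<alpha> (c *\<^sub>C v)) (map (\<lambda>(u, a). (c *\<^sub>C u, a)) (\<alpha> v))) \<and>
     (\<forall>v\<in>cspace n. teq3 (concat [map (\<lambda>(w, b). (w, b, a)) (\<alpha> u). (u, a) \<leftarrow> \<alpha> v])
                         (concat [map (\<lambda>(p, q). (u, p, q)) (\<Delta> a). (u, a) \<leftarrow> \<alpha> v])) \<and>
     (\<forall>v\<in>cspace n. (\<Sum>(u, a)\<leftarrow>\<alpha> v. \<epsilon> a *\<^sub>C u) = v)"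

text \<open>A scalar product on the comodule (a positive definite Hermitian form, conjugate-linear
  in the first variable, i.e. linear on the conjugate space) which is a comodule map
  from the tensor product comodule conj V \<otimes> V to the trivial comodule \<complex>.\<close>
definition invariant_scalar_product ::
  "nat \<Rightarrow> ((nat \<Rightarrow> complex) \<Rightarrow> ((nat \<Rightarrow> complex) \<times> 'a::star_alg) list)
     \<Rightarrow> ((nat \<Rightarrow> complex) \<Rightarrow> (nat \<Rightarrow> complex) \<Rightarrow> complex) \<Rightarrow> bool" where
  "invariant_scalar_product n \<alpha> \<phi> \<longleftrightarrow>
     (\<forall>u\<in>cspace n. \<forall>v\<in>cspace n. \<forall>w\<in>cspace n. \<phi> u (v + w) = \<phi> u v + \<phi> u w) \<and>
     (\<forall>c. \<forall>u\<in>cspace n. \<forall>v\<in>cspace n. \<phi> u (c *\<^sub>C v) = c * \<phi> u v) \<and>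
     (\<forall>u\<in>cspace n. \<forall>v\<in>cspace n. \<phi> v u = cnj (\<phi> u v)) \<and>
     (\<forall>v\<in>cspace n. v \<noteq> 0 \<longrightarrow> Im (\<phi> v v) = 0 \<and> Re (\<phi> v v) > 0) \<and>
     (\<forall>v\<in>cspace n. \<forall>w\<in>cspace n.
        (\<Sum>(v', a)\<leftarrow>\<alpha> v. \<Sum>(w', b)\<leftarrow>\<alpha> w. \<phi> v' w' *\<^sub>C (star a * b)) = \<phi> v w *\<^sub>C 1)"

definition unitarizable :: "('a::star_alg \<Rightarrow> ('a \<times> 'a) list) \<Rightarrow> ('a \<Rightarrow> complex) \<Rightarrow> bool" where
  "unitarizable \<Delta> \<epsilon> \<longleftrightarrow>
     (\<forall>n \<alpha>. right_comodule \<Delta> \<epsilon> n \<alpha> \<longrightarrow> (\<exists>\<phi>. invariant_scalar_product n \<alpha> \<phi>))"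

definition left_coaction ::
  "('a::star_alg \<Rightarrow> ('a \<times> 'a) list) \<Rightarrow> ('a \<Rightarrow> complex) \<Rightarrow> ('z::star_alg \<Rightarrow> ('a \<times> 'z) list) \<Rightarrow> bool" where
  "left_coaction \<Delta> \<epsilon> \<alpha> \<longleftrightarrow>
     (\<forall>z. teq3 (concat [map (\<lambda>(p, q). (p, q, y)) (\<Delta> a). (a, y) \<leftarrow> \<alpha> z])
                (concat [map (\<lambda>(b, x). (a, b, x)) (\<alpha> y). (a, y) \<leftarrow> \<alpha> z])) \<and>
     (\<forall>z. (\<Sum>(a, y)\<leftarrow>\<alpha> z. \<epsilon> a *\<^sub>C y) = z)"

definition galois_map :: "('z::star_alg \<Rightarrow> ('a::star_alg \<times> 'z) list) \<Rightarrow> ('z \<times> 'z) list \<Rightarrow> ('a \<times> 'z) list" where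
  "galois_map \<alpha> xs = concat [map (\<lambda>(a, y). (a, y * w)) (\<alpha> z). (z, w) \<leftarrow> xs]"

definition star_galois_extension ::
  "('a::star_alg \<Rightarrow> ('a \<times> 'a) list) \<Rightarrow> ('a \<Rightarrow> complex) \<Rightarrow> ('z::star_alg \<Rightarrow> ('a \<times> 'z) list) \<Rightarrow> bool" where
  "star_galois_extension \<Delta> \<epsilon> \<alpha> \<longleftrightarrow>
     (\<exists>z::'z. z \<noteq> 0) \<and>
     left_coaction \<Delta> \<epsilon> \<alpha> \<and> tensor_star_hom \<alpha> \<and>
     (\<forall>t. \<exists>s. teq (galois_map \<alpha> s) t) \<and>
     (\<forall>s s'. teq (galois_map \<alpha> s) (galois_map \<alpha> s') \<longrightarrow> teq s s')"

definition haar_measure :: "('z::star_alg \<Rightarrow> ('a::star_alg \<times> 'z) list) \<Rightarrow> ('z \<Rightarrow> complex) \<Rightarrow> bool" where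
  "haar_measure \<alpha> \<mu> \<longleftrightarrow> clinear_fun \<mu> \<and>
     (\<forall>z. (\<Sum>(a, y)\<leftarrow>\<alpha> z. \<mu> y *\<^sub>C a) = \<mu> z *\<^sub>C (1::'a)) \<and> \<mu> 1 = 1"

definition positive_functional :: "('z::star_alg \<Rightarrow> complex) \<Rightarrow> bool" where
  "positive_functional \<mu> \<longleftrightarrow> (\<forall>z. Im (\<mu> (star z * z)) = 0 \<and> Re (\<mu> (star z * z)) \<ge> 0)"

definition cstar_seminorm :: "('z::star_alg \<Rightarrow> real) \<Rightarrow> bool" where
  "cstar_seminorm p \<longleftrightarrow>
     (\<forall>x y. p (x + y) \<le> p x + p y) \<and> (\<forall>c x. p (c *\<^sub>C x) = cmod c * p x) \<and>
     (\<forall>x y. p (x * y) \<le> p x * p y) \<and> (\<forall>x. p (star x * x) = (p x)\<^sup>2)"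

definition cstar_norm :: "('z::star_alg \<Rightarrow> real) \<Rightarrow> bool" where
  "cstar_norm p \<longleftrightarrow> cstar_seminorm p \<and> (\<forall>x. p x = 0 \<longrightarrow> x = 0)"

end

theory Submission
  imports Defs
begin

text \<open>Every \<open>z\<close> lies in a finite-dimensional subcomodule of \<open>Z\<close> with basis \<open>e\<^sub>i\<close>.  An invariant scalar
  product \<open>F\<close> on the corresponding right comodule makes \<open>\<Sum>F\<^sub>i\<^sub>j e\<^sub>i\<^sup>* e\<^sub>j\<close> coinvariant, hence a scalar \<open>c\<close>
  because the Galois map is injective; a Cholesky decomposition of \<open>F\<close> rewrites this as
  \<open>\<Sum>y\<^sub>k\<^sup>* y\<^sub>k = c\<close> with \<open>z\<close> in the span of the \<open>y\<^sub>k\<close>.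

  This bounds left multiplication by \<open>z\<close> in the GNS representation of \<open>\<mu>\<close>, and the resulting operator
  seminorm is a norm because \<open>\<mu>\<close> is faithful: by strong invariance its null space is a subcomodule and
  a left ideal, and surjectivity of the Galois map then forces it to vanish.

  It also bounds \<open>p z\<close> for every C*-seminorm \<open>p\<close>.  Since \<open>Z\<close> is not complete for \<open>p\<close>, the required
  positivity of \<open>y\<^sup>* y\<close> is obtained by norm estimates on polynomials instead of functional calculus.\<close>

section \<open>Linear maps and tensors\<close>

text \<open>The two uses of the sum of squares differ in difficulty. In the GNS form every
  \<open>\<mu> (star (y k * w) * (y k * w))\<close> is nonnegative by hypothesis, so a single
  summand is bounded by the total. For an arbitrary C*-seminorm the same step needs the other
  summands \<open>star (y j) * y j\<close> to be positive in the completion, a statement about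
  spectra that the axioms give only indirectly; most of the work goes into it.

  Only finiteness of the supremum is at stake, so estimates may lose constants: the factor
  \<open>2 * exp 2\<close> comes from a Cauchy estimate and stands where a complete C*-algebra would
  give 1. Definiteness of the supremum is then inherited from the GNS seminorm, which is one of its
  members.

  Since tensors are lists compared through products of functionals, a tensor identity is exploited
  by evaluating one bilinear map on both sides, and a coaction becomes an honest linear map only
  after such an evaluation.\<close>

global_interpretation cvs: vector_space "scaleC :: complex \<Rightarrow> 'v \<Rightarrow> 'v::cvec"
  by standard (auto simp: scaleC_add_right scaleC_add_left scaleC_scaleC scaleC_one)

definition clin :: "('v::cvec \<Rightarrow> 'w::cvec) \<Rightarrow> bool" where
  "clin f \<longleftrightarrow> (\<forall>x y. f (x + y) = f x + f y) \<and> (\<forall>c x. f (c *\<^sub>C x) = c *\<^sub>C f x)"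

lemma clinI:
  assumes "\<And>x y. f (x + y) = f x + f y" "\<And>c x. f (c *\<^sub>C x) = c *\<^sub>C f x"
  shows "clin f"
  using assms by (auto simp: clin_def)

lemma clinear_fun_clin: "clinear_fun f \<longleftrightarrow> clin f"
  by (simp add: clinear_fun_def clin_def scaleC_complex_def)

lemma clin_add: "clin f \<Longrightarrow> f (x + y) = f x + f y"
  and clin_scale: "clin f \<Longrightarrow> f (c *\<^sub>C x) = c *\<^sub>C f x"
  by (auto simp: clin_def)

lemma clin_0: "clin f \<Longrightarrow> f 0 = 0"
  by (metis cvs.scale_zero_left clin_scale)

lemma clin_sum_list: "clin f \<Longrightarrow> f (\<Sum>x\<leftarrow>xs. g x) = (\<Sum>x\<leftarrow>xs. f (g x))"
  by (induction xs) (auto simp: clin_0 clin_add)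

lemma clin_sum: "clin f \<Longrightarrow> f (\<Sum>x\<in>A. g x) = (\<Sum>x\<in>A. f (g x))"
  by (induction A rule: infinite_finite_induct) (auto simp: clin_0 clin_add)

lemma clin_id: "clin (\<lambda>x. x)"
  and clin_zero: "clin (\<lambda>x. 0)"
  by (auto simp: clin_def)

lemma clin_comp: "clin f \<Longrightarrow> clin g \<Longrightarrow> clin (\<lambda>x. f (g x))"
  by (auto simp: clin_def)

lemma clin_plus: "clin f \<Longrightarrow> clin g \<Longrightarrow> clin (\<lambda>x. f x + g x)"
  by (auto simp: clin_def scaleC_add_right)

lemma clin_smul: "clin f \<Longrightarrow> clin (\<lambda>x. c *\<^sub>C f x)"
  by (auto simp: clin_def scaleC_add_right scaleC_scaleC mult.commute)

lemma clin_smul_left: "clin f \<Longrightarrow> clin (\<lambda>x. f x *\<^sub>C (v::'v::cvec))" for f :: "'u::cvec \<Rightarrow> complex"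
  by (auto simp: clin_def scaleC_add_left scaleC_scaleC scaleC_complex_def)

lemma clin_lists: "(\<And>y. clin (\<lambda>x. f x y)) \<Longrightarrow> clin (\<lambda>x. \<Sum>y\<leftarrow>ys. f x y)"
  by (induction ys) (auto intro: clin_plus clin_zero)

lemma clin_mult_left: "clin f \<Longrightarrow> clin (\<lambda>x. b * f x)" for b :: "'b::calg"
  by (auto simp: clin_def distrib_left mult_scaleC_right)

lemma clin_mult_right: "clin f \<Longrightarrow> clin (\<lambda>x. f x * b)" for b :: "'b::calg"
  by (auto simp: clin_def distrib_right mult_scaleC_left)

lemma clin_cmult_left: "clin f \<Longrightarrow> clin (\<lambda>x. b * f x)" for b :: complex
  by (auto simp: clin_def distrib_left scaleC_complex_def)

lemma clin_cmult_right: "clin f \<Longrightarrow> clin (\<lambda>x. f x * b)" for b :: complex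
  by (auto simp: clin_def distrib_right scaleC_complex_def)

lemma clin_star_cnj: "clin f \<Longrightarrow> clin (\<lambda>x. cnj (f (star x)))"
  for f :: "'b::star_alg \<Rightarrow> complex"
  by (auto simp: clin_def star_add star_scaleC scaleC_complex_def)

lemma clin_sums: "(\<And>y. clin (\<lambda>x. f x y)) \<Longrightarrow> clin (\<lambda>x. \<Sum>y\<in>Y. f x y)"
  by (induction Y rule: infinite_finite_induct) (auto intro: clin_plus clin_zero)

text \<open>Coordinates refer to a basis of the whole space that extends \<open>B\<close>, so that
  each functional is linear everywhere and not only on the span of \<open>B\<close>.\<close>

lemma coordinate_functionals:
  assumes "cvs.independent (B :: 'v::cvec set)"
  obtains f where "\<And>b. clin (f b :: 'v \<Rightarrow> complex)"
    "\<And>b c. b \<in> B \<Longrightarrow> c \<in> B \<Longrightarrow> f b c = (if b = c then 1 else 0)"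
    "\<And>v. v \<in> cvs.span B \<Longrightarrow> finite {b. f b v \<noteq> 0} \<and> {b. f b v \<noteq> 0} \<subseteq> B
        \<and> v = (\<Sum>b | f b v \<noteq> 0. f b v *\<^sub>C b)"
proof -
  define E where "E = cvs.extend_basis B"
  have E: "cvs.independent E" "B \<subseteq> E" "cvs.span E = UNIV"
    using assms by (simp_all add: E_def cvs.independent_extend_basis cvs.extend_basis_superset)
  define f where "f b v = cvs.representation E v b" for b v
  have lin: "clin (f b)" for b
    by (auto intro!: clinI simp: f_def cvs.representation_add cvs.representation_scale E scaleC_complex_def)
  have ff: "f b c = (if b = c then 1 else 0)" if "b \<in> B" "c \<in> B" for b c
    using cvs.representation_basis[OF E(1), of c] that E(2) by (auto simp: f_def)
  have eqB: "cvs.representation E v = cvs.representation B v" if "v \<in> cvs.span B" for v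
    using cvs.representation_extend[OF E(1) that E(2)] .
  have "finite {b. f b v \<noteq> 0} \<and> {b. f b v \<noteq> 0} \<subseteq> B
        \<and> v = (\<Sum>b | f b v \<noteq> 0. f b v *\<^sub>C b)" if "v \<in> cvs.span B" for v
    using cvs.finite_representation[of B v] cvs.representation_ne_zero[of B v]
      cvs.sum_nonzero_representation_eq[OF assms that]
    by (auto simp: f_def eqB[OF that])
  with lin ff show ?thesis by (rule that)
qed

text \<open>If x and y differ, then \<open>{x - y}\<close> is independent, and its coordinate
  functional has values on x and y that differ by 1.\<close>

lemma functionals_separate:
  assumes "\<And>f::'v::cvec \<Rightarrow> complex. clin f \<Longrightarrow> f x = f y"
  shows "x = y"
proof (rule ccontr)
  assume "x \<noteq> y"
  then have "cvs.independent {x - y}" by simp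
  then obtain f where f: "\<And>b. clin (f b :: 'v \<Rightarrow> complex)"
    "\<And>b c. b \<in> {x-y} \<Longrightarrow> c \<in> {x-y} \<Longrightarrow> f b c = (if b = c then 1 else 0)"
    by (rule coordinate_functionals) blast
  have "f (x - y) x = f (x - y) (y + (x - y))" by simp
  also have "\<dots> = f (x - y) y + 1"
    unfolding clin_add[OF f(1)] using f(2) by simp
  finally show False using assms[OF f(1), of "x-y"] by simp
qed

section \<open>Equality of tensors tested by multilinear maps\<close>

lemma teq_clin: "teq xs ys \<longleftrightarrow> (\<forall>f g. clin f \<longrightarrow> clin g \<longrightarrow>
      (\<Sum>(v, w)\<leftarrow>xs. f v * (g w :: complex)) = (\<Sum>(v, w)\<leftarrow>ys. f v * g w))"
  by (simp add: teq_def clinear_fun_clin)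

lemma teq_sym: "teq xs ys \<Longrightarrow> teq ys xs"
  and teq_trans: "teq xs ys \<Longrightarrow> teq ys zs \<Longrightarrow> teq xs zs"
  by (auto simp: teq_def)

lemma sum_list_concat_map:
  "(\<Sum>x\<leftarrow>concat (map g xs). f x) = (\<Sum>x\<leftarrow>xs. \<Sum>y\<leftarrow>g x. (f y :: 'b::comm_monoid_add))"
  by (induction xs) auto

lemma teq_slice:
  assumes "teq xs ys" "clin f"
  shows "(\<Sum>(v, w)\<leftarrow>xs. f v *\<^sub>C w) = (\<Sum>(v, w)\<leftarrow>ys. f v *\<^sub>C w)"
proof (rule functionals_separate)
  fix g :: "'b \<Rightarrow> complex" assume g: "clin g"
  show "g (\<Sum>(v, w)\<leftarrow>xs. f v *\<^sub>C w) = g (\<Sum>(v, w)\<leftarrow>ys. f v *\<^sub>C w)"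
    using assms g by (simp add: teq_clin clin_sum_list case_prod_unfold clin_scale scaleC_complex_def)
qed

definition cbilin :: "('u::cvec \<Rightarrow> 'v::cvec \<Rightarrow> 'w::cvec) \<Rightarrow> bool" where
  "cbilin B \<longleftrightarrow> (\<forall>v. clin (B v)) \<and> (\<forall>w. clin (\<lambda>v. B v w))"

lemma finite_coordinates:
  fixes X :: "'v::cvec set"
  assumes "finite X"
  obtains E f where "finite E" "\<And>e. clin (f e :: 'v \<Rightarrow> complex)"
    "\<And>v. v \<in> X \<Longrightarrow> v = (\<Sum>e\<in>E. f e v *\<^sub>C e)"
proof -
  obtain Bs :: "'v set" where Bs: "cvs.independent Bs" "UNIV \<subseteq> cvs.span Bs"
    using cvs.basis_exists[of UNIV] by metis
  obtain f where f: "\<And>b. clin (f b :: 'v \<Rightarrow> complex)"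
    "\<And>v. v \<in> cvs.span Bs \<Longrightarrow> finite {b. f b v \<noteq> 0} \<and> {b. f b v \<noteq> 0} \<subseteq> Bs
        \<and> v = (\<Sum>b | f b v \<noteq> 0. f b v *\<^sub>C b)"
    by (rule coordinate_functionals[OF Bs(1)]) blast
  have f2: "finite {b. f b v \<noteq> 0}" "v = (\<Sum>b | f b v \<noteq> 0. f b v *\<^sub>C b)" for v
    using f(2)[of v] Bs(2) by auto
  define E where "E = (\<Union>v\<in>X. {b. f b v \<noteq> 0})"
  have fin: "finite E" unfolding E_def using f2(1) assms by auto
  have "v = (\<Sum>e\<in>E. f e v *\<^sub>C e)" if "v \<in> X" for v
  proof -
    have "(\<Sum>b | f b v \<noteq> 0. f b v *\<^sub>C b) = (\<Sum>b\<in>E. f b v *\<^sub>C b)"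
      using fin that by (intro sum.mono_neutral_left) (auto simp: E_def)
    then show ?thesis using f2(2)[of v] by simp
  qed
  with fin f(1) show ?thesis by (rule that)
qed

lemma sum_list_sum_swap:
  "(\<Sum>x\<leftarrow>xs. \<Sum>e\<in>E. f x e) = (\<Sum>e\<in>E. \<Sum>x\<leftarrow>xs. (f x e :: 'b::comm_monoid_add))"
  by (induction xs) (auto simp: sum.distrib)

lemma sum_list_coordinates:
  assumes "\<And>x. x \<in> set xs \<Longrightarrow> g x = (\<Sum>e\<in>E. f e (g x) *\<^sub>C e)"
    and "\<And>x. clin (B x)"
  shows "(\<Sum>x\<leftarrow>xs. B x (g x)) = (\<Sum>e\<in>E. \<Sum>x\<leftarrow>xs. f e (g x) *\<^sub>C B x e)"
proof -
  have "B x (g x) = (\<Sum>e\<in>E. f e (g x) *\<^sub>C B x e)" if "x \<in> set xs" for x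
    by (subst assms(1)[OF that]) (simp add: clin_sum[OF assms(2)] clin_scale[OF assms(2)])
  then show ?thesis
    by (simp add: sum_list_sum_swap[symmetric] cong: map_cong)
qed

text \<open>This is the universal property of the tensor product. Writing the first legs in finitely
  many coordinates turns the sum into \<open>B\<close> applied to basis vectors and slices, and
  slices depend only on the tensor.\<close>

lemma teq_cbilin:
  assumes "teq xs ys" "cbilin B"
  shows "(\<Sum>(v, w)\<leftarrow>xs. B v w) = (\<Sum>(v, w)\<leftarrow>ys. B v w)"
proof -
  have B: "clin (B v)" "clin (\<lambda>v. B v w)" for v w using assms(2) by (auto simp: cbilin_def)
  have "finite (fst ` set (xs @ ys))" by simp
  then obtain E f where f: "\<And>e. clin (f e :: 'a \<Rightarrow> complex)"
    "\<And>v. v \<in> fst ` set (xs @ ys) \<Longrightarrow> v = (\<Sum>e\<in>E. f e v *\<^sub>C e)"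
    by (rule finite_coordinates) blast
  have "(\<Sum>(v, w)\<leftarrow>zs. B v w) = (\<Sum>e\<in>E. B e (\<Sum>(v, w)\<leftarrow>zs. f e v *\<^sub>C w))"
    if "set zs \<subseteq> set (xs @ ys)" for zs
  proof -
    have "(\<Sum>x\<leftarrow>zs. B (fst x) (snd x)) = (\<Sum>e\<in>E. \<Sum>x\<leftarrow>zs. f e (fst x) *\<^sub>C B e (snd x))"
      by (rule sum_list_coordinates[where B = "\<lambda>x v. B v (snd x)"]) (use f(2) that B(2) in auto)
    then show ?thesis
      by (simp add: case_prod_unfold clin_sum_list[OF B(1)] clin_scale[OF B(1)])
  qed
  from this[of xs] this[of ys] show ?thesis
    by (simp add: teq_slice[OF assms(1) f(1)])
qed

lemma cbilinI: "(\<And>v. clin (B v)) \<Longrightarrow> (\<And>w. clin (\<lambda>v. B v w)) \<Longrightarrow> cbilin B"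
  by (simp add: cbilin_def)

lemma teqI:
  assumes "\<And>B :: 'v::cvec \<Rightarrow> 'w::cvec \<Rightarrow> complex. cbilin B \<Longrightarrow>
    (\<Sum>(v, w)\<leftarrow>xs. B v w) = (\<Sum>(v, w)\<leftarrow>ys. B v w)"
  shows "teq xs ys"
  unfolding teq_clin
  by (intro allI impI assms cbilinI) (auto intro!: clin_cmult_left clin_cmult_right)

text \<open>A normal form whose second legs are slices. In the faithfulness proof it exhibits the
  second legs of \<open>\<alpha> z\<close> as elements on which \<open>\<mu>\<close> can be
  computed.\<close>

lemma teq_expansion:
  fixes xs :: "('v::cvec \<times> 'w::cvec) list"
  obtains es f where "\<And>e. clin (f e :: 'v \<Rightarrow> complex)"
    "teq xs (map (\<lambda>e. (e, \<Sum>(v, w)\<leftarrow>xs. f e v *\<^sub>C w)) es)"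
proof -
  obtain E f where f: "finite E" "\<And>e. clin (f e :: 'v \<Rightarrow> complex)"
    "\<And>v. v \<in> fst ` set xs \<Longrightarrow> v = (\<Sum>e\<in>E. f e v *\<^sub>C e)"
    by (rule finite_coordinates[of "fst ` set xs"]) auto
  obtain es where es: "set es = E" "distinct es" using f(1) finite_distinct_list by blast
  have "teq xs (map (\<lambda>e. (e, \<Sum>(v, w)\<leftarrow>xs. f e v *\<^sub>C w)) es)"
  proof (rule teqI)
    fix B :: "'v \<Rightarrow> 'w \<Rightarrow> complex" assume "cbilin B"
    then have B: "clin (B v)" "clin (\<lambda>v. B v w)" for v w by (auto simp: cbilin_def)
    have "(\<Sum>x\<leftarrow>xs. B (fst x) (snd x)) = (\<Sum>e\<in>E. \<Sum>x\<leftarrow>xs. f e (fst x) *\<^sub>C B e (snd x))"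
      by (rule sum_list_coordinates[where B = "\<lambda>x v. B v (snd x)"]) (use f(3) B(2) in auto)
    then show "(\<Sum>(v, w)\<leftarrow>xs. B v w) =
       (\<Sum>(v, w)\<leftarrow>map (\<lambda>e. (e, \<Sum>(v, w)\<leftarrow>xs. f e v *\<^sub>C w)) es. B v w)"
      using es by (simp add: case_prod_unfold clin_sum_list[OF B(1)] clin_scale[OF B(1)] o_def
          sum_list_distinct_conv_sum_set)
  qed
  with f(2) show ?thesis by (rule that)
qed

definition ctrilin :: "('t::cvec \<Rightarrow> 'u::cvec \<Rightarrow> 'v::cvec \<Rightarrow> 'w::cvec) \<Rightarrow> bool" where
  "ctrilin B \<longleftrightarrow> (\<forall>u v. clin (B u v)) \<and> (\<forall>u w. clin (\<lambda>v. B u v w)) \<and> (\<forall>v w. clin (\<lambda>u. B u v w))"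

lemma ctrilinI: "(\<And>u v. clin (B u v)) \<Longrightarrow> (\<And>u w. clin (\<lambda>v. B u v w)) \<Longrightarrow> (\<And>v w. clin (\<lambda>u. B u v w)) \<Longrightarrow> ctrilin B"
  by (simp add: ctrilin_def)

text \<open>Applying a functional to the first leg leaves an equality of tensors with two legs, so
  coordinates in the first leg reduce everything to \<open>teq_cbilin\<close>.\<close>

lemma teq3_ctrilin:
  assumes "teq3 xs ys" "ctrilin B"
  shows "(\<Sum>(u, v, w)\<leftarrow>xs. B u v w) = (\<Sum>(u, v, w)\<leftarrow>ys. B u v w)"
proof -
  have T: "clin (B u v)" "clin (\<lambda>v. B u v w)" "clin (\<lambda>u. B u v w)" for u v w
    using assms(2) by (auto simp: ctrilin_def)
  have slice: "teq (map (\<lambda>(u, v, w). (f u *\<^sub>C v, w)) xs) (map (\<lambda>(u, v, w). (f u *\<^sub>C v, w)) ys)"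
    if "clin f" for f :: "'a \<Rightarrow> complex"
    using assms(1) that unfolding teq_clin teq3_def clinear_fun_clin
    by (simp add: o_def case_prod_unfold clin_scale scaleC_complex_def)
  have "finite (fst ` set (xs @ ys))" by simp
  then obtain E f where f: "\<And>e. clin (f e :: 'a \<Rightarrow> complex)"
    "\<And>v. v \<in> fst ` set (xs @ ys) \<Longrightarrow> v = (\<Sum>e\<in>E. f e v *\<^sub>C e)"
    by (rule finite_coordinates) blast
  have *: "(\<Sum>(u, v, w)\<leftarrow>zs. B u v w) =
      (\<Sum>e\<in>E. \<Sum>(v, w)\<leftarrow>map (\<lambda>(u, v, w). (f e u *\<^sub>C v, w)) zs. B e v w)"
    if "set zs \<subseteq> set (xs @ ys)" for zs
  proof -
    have "(\<Sum>x\<leftarrow>zs. B (fst x) (fst (snd x)) (snd (snd x))) =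
        (\<Sum>e\<in>E. \<Sum>x\<leftarrow>zs. f e (fst x) *\<^sub>C B e (fst (snd x)) (snd (snd x)))"
      by (rule sum_list_coordinates[where B = "\<lambda>x u. B u (fst (snd x)) (snd (snd x))"])
        (use f(2) that T(3) in auto)
    then show ?thesis
      by (simp add: case_prod_unfold o_def clin_scale[OF T(2)])
  qed
  have "cbilin (B e)" for e using T by (auto intro: cbilinI)
  then show ?thesis
    using *[of xs] *[of ys] by (simp only: teq_cbilin[OF slice[OF f(1)]] set_append Un_upper1 Un_upper2)
qed

text \<open>The involution is conjugate-linear, so it cannot be composed with a functional directly.
  The functional \<open>\<lambda>x. cnj (f (star x))\<close> is linear again; testing with it and
  conjugating the result gives the claim.\<close>

lemma teq_map_star:
  assumes "teq xs ys"
  shows "teq (map (\<lambda>(a, b). (star a, star b)) xs) (map (\<lambda>(a, b). (star a, star b)) ys)"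
proof -
  have cnj_list: "cnj (\<Sum>x\<leftarrow>zs. h x) = (\<Sum>x\<leftarrow>zs. cnj (h x))" for h :: "'a \<times> 'b \<Rightarrow> complex" and zs
    by (induction zs) auto
  have "(\<Sum>(v, w)\<leftarrow>xs. f (star v) * g (star w)) = (\<Sum>(v, w)\<leftarrow>ys. f (star v) * g (star w))"
    if "clin f" "clin g" for f :: "'a \<Rightarrow> complex" and g :: "'b \<Rightarrow> complex"
  proof -
    have "(\<Sum>(v, w)\<leftarrow>xs. cnj (f (star v)) * cnj (g (star w))) =
        (\<Sum>(v, w)\<leftarrow>ys. cnj (f (star v)) * cnj (g (star w)))"
      using assms clin_star_cnj[OF that(1)] clin_star_cnj[OF that(2)] unfolding teq_clin by blast
    then have "cnj (\<Sum>(v, w)\<leftarrow>xs. cnj (f (star v)) * cnj (g (star w))) =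
        cnj (\<Sum>(v, w)\<leftarrow>ys. cnj (f (star v)) * cnj (g (star w)))" by simp
    then show ?thesis unfolding cnj_list by (simp add: case_prod_unfold)
  qed
  then show ?thesis by (simp add: teq_clin o_def case_prod_unfold)
qed

section \<open>Positivity for C*-seminorms\<close>

lemma star_0: "star (0::'z::star_alg) = 0"
  using star_scaleC[of 0 0] by simp

lemma star_minus: "star (- x) = - star (x::'z::star_alg)"
  by (metis add_eq_0_iff star_0 star_add)

lemma star_diff: "star (x - y) = star x - star (y::'z::star_alg)"
  by (metis diff_conv_add_uminus star_add star_minus)

lemma star_1: "star (1::'z::star_alg) = 1"
  by (metis mult_1_left star_mult star_star mult_1_right)

lemma star_power: "star (x ^ n) = star (x::'z::star_alg) ^ n"
  by (induction n) (auto simp: star_1 star_mult power_commutes)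

lemma star_sum: "star (sum f A) = (\<Sum>i\<in>A. star (f i :: 'z::star_alg))"
  by (induction A rule: infinite_finite_induct) (auto simp: star_0 star_add)

lemmas star_simps = star_star star_0 star_1 star_add star_minus star_diff star_mult star_scaleC
  star_power

abbreviation scal :: "real \<Rightarrow> 'z::calg" where "scal t \<equiv> complex_of_real t *\<^sub>C 1"

lemma scal_mult: "scal t * x = complex_of_real t *\<^sub>C (x::'z::calg)"
  by (simp add: mult_scaleC_left)

lemma scaleC_neg_one: "(-1) *\<^sub>C x = - (x::'z::cvec)"
  using cvs.scale_minus_left[of 1 x] by (simp add: scaleC_one)

lemma scaleC_two: "2 *\<^sub>C x = x + (x::'z::cvec)"
  using scaleC_add_left[of 1 1 x] by (simp add: scaleC_one)

lemma scaleC_half: "(1/2) *\<^sub>C (x + x) = (x::'z::cvec)"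
  by (simp add: scaleC_two[symmetric] scaleC_scaleC scaleC_one)

locale cstar =
  fixes p :: "'z::star_alg \<Rightarrow> real"
  assumes p: "cstar_seminorm p"
begin

lemma add_le: "p (x + y) \<le> p x + p y"
  and scale: "p (c *\<^sub>C x) = cmod c * p x"
  and mult_le: "p (x * y) \<le> p x * p y"
  and star_self: "p (star x * x) = (p x)\<^sup>2"
  using p by (auto simp: cstar_seminorm_def)

lemma zero: "p 0 = 0"
  using scale[of 0 0] by simp

lemma minus: "p (- x) = p x"
  using scale[of "-1" x] by (simp add: scaleC_neg_one)

lemma nonneg: "p x \<ge> 0"
  using add_le[of x "- x"] by (simp add: zero minus)

lemma diff_le: "p (x - y) \<le> p x + p y"
  using add_le[of x "- y"] by (simp add: minus)

lemma p_star: "p (star x) = p x"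
proof -
  have "p x \<le> p (star x)" for x
  proof (cases "p x = 0")
    case False
    have "p x * p x \<le> p (star x) * p x"
      using star_self[of x] mult_le[of "star x" x] by (simp add: power2_eq_square)
    then show ?thesis using False nonneg[of x] by simp
  qed (simp add: nonneg)
  from this[of x] this[of "star x"] show ?thesis by (simp add: star_star)
qed

text \<open>\<open>p 1\<close> equals its own square, hence is 0 or 1; the value 0 is possible
  because the zero function is a C*-seminorm.\<close>

lemma one_le: "p 1 \<le> 1"
proof -
  have "p 1 = (p 1)\<^sup>2" using star_self[of 1] by (simp add: star_1)
  then show ?thesis by (auto simp: power2_eq_square)
qed

lemma scal_le: "t \<ge> 0 \<Longrightarrow> p (scal t) \<le> t"
  using one_le nonneg[of 1] by (simp add: scale mult_left_le)

lemma power_le: "p (x ^ n) \<le> p x ^ n"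
proof (induction n)
  case 0 show ?case using one_le by simp
next
  case (Suc n)
  then have "p x * p (x ^ n) \<le> p x * p x ^ n" by (intro mult_left_mono nonneg)
  with mult_le[of x "x ^ n"] show ?case by simp
qed

lemma sum_le: "p (sum f A) \<le> (\<Sum>i\<in>A. p (f i))"
proof (induction A rule: infinite_finite_induct)
  case (insert x F)
  then show ?case using add_le[of "f x" "sum f F"] by simp
qed (auto simp: zero)

text \<open>The C*-identity gives the exponents \<open>2 ^ k\<close>. For general n, splitting
  \<open>g ^ (2 ^ n)\<close> into \<open>g ^ n\<close> and the remaining power bounds
  \<open>p (g ^ n)\<close> from below, since no other factor can exceed its submultiplicative
  bound.\<close>

lemma herm_power:
  assumes "star g = g" "n > 0"
  shows "p (g ^ n) = p g ^ n"
proof -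
  have two: "p (g ^ (2 ^ k)) = p g ^ (2 ^ k)" for k
  proof (induction k)
    case (Suc k)
    have "g ^ (2 ^ Suc k) = star (g ^ 2 ^ k) * g ^ 2 ^ k"
      by (simp add: star_power assms mult_2 power_add)
    then show ?case using Suc by (simp add: star_self power_mult[symmetric] mult.commute)
  qed simp
  show ?thesis
  proof (cases "p g = 0")
    case True
    then show ?thesis using power_le[of g n] nonneg[of "g^n"] assms(2) by (simp add: zero_power)
  next
    case False
    then have pos: "p g > 0" using nonneg[of g] by simp
    have n: "n \<le> 2 ^ n" by (simp add: less_imp_le)
    have "p g ^ n * p g ^ (2 ^ n - n) = p (g ^ (2 ^ n))"
      by (simp only: two power_add[symmetric]) (simp add: n)
    also have "\<dots> = p (g ^ n * g ^ (2 ^ n - n))" by (simp only: power_add[symmetric]) (simp add: n)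
    also have "\<dots> \<le> p (g ^ n) * p g ^ (2 ^ n - n)"
      using mult_le[of "g^n" "g ^ (2^n-n)"] power_le[of g "2^n-n"]
      by (meson mult_left_mono nonneg order_trans)
    finally have "p g ^ n \<le> p (g ^ n)" using pos by simp
    with power_le[of g n] show ?thesis by simp
  qed
qed

text \<open>For hermitian \<open>g\<close> in a C*-algebra, \<open>p (T + g) - T\<close> decreases to the largest spectral value of
  \<open>g\<close> as \<open>T\<close> tends to infinity, so \<open>upb g m\<close> says that the spectrum of \<open>g\<close> lies below \<open>m\<close>.  It makes
  sense without completeness and is subadditive.\<close>

definition upb :: "'z \<Rightarrow> real \<Rightarrow> bool" where
  "upb g m \<longleftrightarrow> (\<forall>e>0. \<exists>T0. \<forall>T\<ge>T0. p (scal T + g) \<le> T + m + e)"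

section \<open>Arithmetic of upper spectral bounds\<close>

lemma upb_add:
  assumes "upb g m" "upb g' m'"
  shows "upb (g + g') (m + m')"
  unfolding upb_def
proof (intro allI impI)
  fix e :: real assume "e > 0"
  then have "e/2 > 0" by simp
  obtain T0 where T0: "\<And>T. T \<ge> T0 \<Longrightarrow> p (scal T + g) \<le> T + m + e/2"
    using assms(1) \<open>e/2 > 0\<close> unfolding upb_def by blast
  obtain T1 where T1: "\<And>T. T \<ge> T1 \<Longrightarrow> p (scal T + g') \<le> T + m' + e/2"
    using assms(2) \<open>e/2 > 0\<close> unfolding upb_def by blast
  show "\<exists>T0. \<forall>T\<ge>T0. p (scal T + (g + g')) \<le> T + (m + m') + e"
  proof (intro exI allI impI)
    fix T assume T: "T \<ge> 2 * max T0 T1"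
    \<comment> \<open>Each summand receives half of the shift, so the two bounds add without
      loss.\<close>
    have "scal T = scal (T/2) + (scal (T/2) :: 'z)"
      by (simp flip: scaleC_add_left of_real_add)
    then have "scal T + (g + g') = (scal (T/2) + g) + (scal (T/2) + g')" by simp
    then have "p (scal T + (g + g')) \<le> p (scal (T/2) + g) + p (scal (T/2) + g')"
      using add_le by metis
    also have "\<dots> \<le> (T/2 + m + e/2) + (T/2 + m' + e/2)"
      using T by (intro add_mono T0 T1) auto
    finally show "p (scal T + (g + g')) \<le> T + (m + m') + e" by simp
  qed
qed

lemma upb_p: "p g \<le> m \<Longrightarrow> upb g m"
  unfolding upb_def
proof (intro allI impI exI)
  fix e T :: real assume "p g \<le> m" "e > 0" "T \<ge> 0"
  then show "p (scal T + g) \<le> T + m + e"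
    using add_le[of "scal T" g] scal_le[of T] by linarith
qed

lemma upb_mono: "upb g m \<Longrightarrow> m \<le> m' \<Longrightarrow> upb g m'"
  unfolding upb_def by (meson add_left_mono add_right_mono order_trans)

lemma upb_lim:
  assumes "\<And>e. e > 0 \<Longrightarrow> upb g (m + e)"
  shows "upb g m"
  unfolding upb_def
proof (intro allI impI)
  fix e :: real assume "e > 0"
  then have "\<exists>T0. \<forall>T\<ge>T0. p (scal T + g) \<le> T + (m + e/2) + e/2"
    using assms[of "e/2"] unfolding upb_def by (meson half_gt_zero)
  then show "\<exists>T0. \<forall>T\<ge>T0. p (scal T + g) \<le> T + m + e" by (simp add: add.assoc)
qed

lemma upb_scale:
  assumes "upb g m" "c \<ge> 0"
  shows "upb (complex_of_real c *\<^sub>C g) (c * m)"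
proof (cases "c = 0")
  case True then show ?thesis using upb_p[of 0 0] by (simp add: zero)
next
  case False
  then have c: "c > 0" using assms by simp
  show ?thesis unfolding upb_def
  proof (intro allI impI)
    fix e :: real assume "e > 0"
    then have "e / c > 0" using c by simp
    then obtain T0 where T0: "\<And>T. T \<ge> T0 \<Longrightarrow> p (scal T + g) \<le> T + m + e/c"
      using assms(1) unfolding upb_def by blast
    show "\<exists>T0. \<forall>T\<ge>T0. p (scal T + complex_of_real c *\<^sub>C g) \<le> T + c * m + e"
    proof (intro exI allI impI)
      fix T assume T: "T \<ge> c * T0"
      have "scal T + complex_of_real c *\<^sub>C g = complex_of_real c *\<^sub>C (scal (T/c) + g)"
        using c by (simp add: scaleC_add_right scaleC_scaleC)
      then have "p (scal T + complex_of_real c *\<^sub>C g) = c * p (scal (T/c) + g)"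
        using c by (simp add: scale)
      also have "\<dots> \<le> c * (T/c + m + e/c)"
        using c T by (intro mult_left_mono T0) (auto simp: field_simps)
      also have "\<dots> = T + c * m + e" using c by (simp add: field_simps)
      finally show "p (scal T + complex_of_real c *\<^sub>C g) \<le> T + c * m + e" .
    qed
  qed
qed

lemma upb_scal: "upb (scal c) c"
  unfolding upb_def
proof (intro allI impI exI)
  fix e T :: real assume "e > 0" "T \<ge> - c"
  have "scal T + scal c = (scal (T + c) :: 'z)" by (simp add: scaleC_add_left)
  then show "p (scal T + scal c) \<le> T + c + e"
    using scal_le[of "T + c"] \<open>e > 0\<close> \<open>T \<ge> - c\<close> by simp
qed

lemma upb_sum:
  assumes "finite A" "\<And>i. i \<in> A \<Longrightarrow> upb (f i) (m i)"
  shows "upb (sum f A) (sum m A)"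
  using assms by (induction A rule: finite_induct) (auto intro: upb_add upb_p simp: zero)

text \<open>\<open>p (scal T + g) - T\<close> does not increase with T. Hence a bound that fails for
  arbitrarily large T fails for every T, which is how the lemma is used later.\<close>

lemma upb_antimono:
  assumes "p (scal T + g) \<le> T + m" "T \<le> T'"
  shows "p (scal T' + g) \<le> T' + m"
proof -
  have "scal T' + g = (scal T + g) + scal (T' - T)"
    by (simp add: cvs.scale_left_diff_distrib)
  then have "p (scal T' + g) \<le> p (scal T + g) + p (scal (T' - T))" by (metis add_le)
  then show ?thesis using scal_le[of "T' - T"] assms by linarith
qed

text \<open>\<open>u = 1 + i s a - s\<^sup>2a\<^sup>2/2\<close> is unitary up to order \<open>s\<^sup>4\<close> and has real part \<open>1 - s\<^sup>2a\<^sup>2/2\<close>.\<close>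

lemma herm_square_estimate:
  assumes a: "star a = a"
  shows "p (1 - complex_of_real (s\<^sup>2/2) *\<^sub>C (a * a)) \<le> 1 + s^4 * p a ^ 4"
proof -
  define b where "b = 1 - complex_of_real (s\<^sup>2/2) *\<^sub>C (a * a)"
  define u where "u = b + (\<i> * s) *\<^sub>C a"
  have sb: "star b = b" by (simp add: b_def star_simps a)
  have su: "star u = b - (\<i> * s) *\<^sub>C a"
    by (simp add: u_def star_simps sb a)
  have ba: "b * a = a * b" by (simp add: b_def algebra_simps mult_scaleC_left mult_scaleC_right)
  have "star u * u = b * b + (complex_of_real s * complex_of_real s) *\<^sub>C (a * a)"
    by (subst su) (simp add: u_def algebra_simps mult_scaleC_left mult_scaleC_right ba scaleC_scaleC
        cvs.scale_right_diff_distrib)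
  also have "\<dots> = 1 + complex_of_real (s^4/4) *\<^sub>C (a ^ 4)"
  proof -
    define c where "c = complex_of_real (s\<^sup>2/2)"
    have cc: "complex_of_real s * complex_of_real s = c + c" "complex_of_real (s^4/4) = c * c"
      by (simp_all add: c_def power2_eq_square power4_eq_xxxx)
    show ?thesis unfolding cc b_def c_def[symmetric] scaleC_add_left
      by (simp add: algebra_simps mult_scaleC_left mult_scaleC_right scaleC_scaleC
          cvs.scale_right_diff_distrib power4_eq_xxxx)
  qed
  finally have "(p u)\<^sup>2 = p (1 + complex_of_real (s^4/4) *\<^sub>C (a ^ 4))"
    using star_self[of u] by simp
  also have "\<dots> \<le> 1 + s^4/4 * p a ^ 4"
    using add_le[of 1 "complex_of_real (s^4/4) *\<^sub>C (a ^ 4)"] one_le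
      mult_left_mono[OF power_le[of a 4], of "s^4/4"] by (simp add: scale norm_power)
  also have "\<dots> \<le> (1 + s^4 * p a ^ 4)\<^sup>2"
  proof -
    have "1 + t/4 \<le> (1 + t)\<^sup>2" if "t \<ge> 0" for t :: real
      using that by (simp add: power2_eq_square algebra_simps)
    from this[of "s^4 * p a ^ 4"] show ?thesis by simp
  qed
  finally have pu: "p u \<le> 1 + s^4 * p a ^ 4"
    by (rule power2_le_imp_le) simp
  have "b + b = u + star u" by (simp add: su) (simp add: u_def)
  then have "p (b + b) \<le> p u + p u" using add_le[of u "star u"] by (simp add: p_star)
  moreover have "p (b + b) = 2 * p b" by (simp add: scale flip: scaleC_two)
  ultimately show ?thesis using pu by (simp add: b_def)
qed

lemma upb_herm_square:
  assumes a: "star a = a"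
  shows "upb (- (a * a)) 0"
  unfolding upb_def
proof (intro allI impI)
  fix e :: real assume e: "e > 0"
  show "\<exists>T0. \<forall>T\<ge>T0. p (scal T + - (a * a)) \<le> T + 0 + e"
  proof (intro exI allI impI)
    fix T assume T: "T \<ge> max 1 (4 * p a ^ 4 / e)"
    \<comment> \<open>With this s the element is T times \<open>1 - s^2/2 * a^2\<close>, and the
      error \<open>T * s^4 * p a ^ 4\<close> equals \<open>4 * p a ^ 4 / T\<close>, which tends to
      0.\<close>
    define s where "s = sqrt (2 / T)"
    have s2: "s\<^sup>2 = 2 / T" using T by (simp add: s_def)
    have s4: "s ^ 4 = 4 / T\<^sup>2" using arg_cong[OF s2, of "\<lambda>x. x\<^sup>2"] by (simp add: power_divide)
    have "scal T + - (a * a) = complex_of_real T *\<^sub>C (1 - complex_of_real (s\<^sup>2/2) *\<^sub>C (a * a))"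
      using T by (simp add: s2 cvs.scale_right_diff_distrib scaleC_scaleC scaleC_one flip: of_real_mult)
    then have "p (scal T + - (a * a)) = T * p (1 - complex_of_real (s\<^sup>2/2) *\<^sub>C (a * a))"
      using T by (simp add: scale)
    also have "\<dots> \<le> T * (1 + s^4 * p a ^ 4)"
      using T by (intro mult_left_mono herm_square_estimate a) auto
    also have "\<dots> = T + 4 * p a ^ 4 / T"
      unfolding s4 using T by (simp add: field_simps power2_eq_square)
    also have "4 * p a ^ 4 / T \<le> e"
      using T e by (simp add: field_simps)
    finally show "p (scal T + - (a * a)) \<le> T + 0 + e" by simp
  qed
qed

text \<open>Iterates \<open>1 - w = (1 - w)\<^sup>2/2 + (1 - w\<^sup>2)/2\<close>.\<close>

lemma upb_commuting_square_approx:
  assumes g: "star g = g" and "star w = w" "p w \<le> 1" "w * g = g * w"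
  shows "upb (- ((1 - w) * (g * g))) (2 * p (g * g) / 2 ^ J)"
  using assms(2-)
proof (induction J arbitrary: w)
  \<comment> \<open>A crude norm bound suffices to start: each later step halves whatever error it
    inherits.\<close>
  case 0
  have "p ((1 - w) * (g * g)) \<le> p (1 - w) * p (g * g)" by (rule mult_le)
  also have "\<dots> \<le> 2 * p (g * g)"
    using diff_le[of 1 w] one_le 0 by (intro mult_right_mono nonneg) simp
  finally show ?case by (intro upb_p) (simp add: minus)
next
  case (Suc J)
  have ww: "p (w * w) \<le> 1"
    using mult_le[of w w] Suc.prems(2) nonneg[of w] by (meson mult_le_one order_trans)
  have c: "w * w * g = g * (w * w)" using Suc.prems by (metis mult.assoc)
  \<comment> \<open>As w commutes with g, \<open>k\<close> is hermitian and \<open>k * k\<close>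
    accounts for the summand with \<open>(1 - w)^2\<close>. The other summand has the same shape
    with \<open>w * w\<close>, again a hermitian contraction commuting with g.\<close>
  define k where "k = (1 - w) * g"
  have "upb (- ((1 - w * w) * (g * g))) (2 * p (g * g) / 2 ^ J)"
    using Suc.prems ww c by (intro Suc.IH) (auto simp: star_mult)
  moreover have "upb (- (k * k)) 0"
    using Suc.prems g by (intro upb_herm_square) (simp add: k_def star_simps algebra_simps)
  ultimately have "upb (complex_of_real (1/2) *\<^sub>C (- ((1 - w * w) * (g * g)) + - (k * k)))
      (1/2 * (2 * p (g * g) / 2 ^ J + 0))"
    by (intro upb_scale upb_add) auto
  moreover have "- ((1 - w * w) * (g * g)) + - (k * k) = - ((1 - w) * (g * g)) + - ((1 - w) * (g * g))"
  proof -
    have "k * k = (1 - w) * (1 - w) * (g * g)"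
      unfolding k_def using Suc.prems(3) by (simp add: algebra_simps) (metis mult.assoc)
    then show ?thesis by (simp add: algebra_simps)
  qed
  ultimately show ?case using scaleC_half[of "- ((1 - w) * (g * g))"] by simp
qed

text \<open>This replaces the fact that a product of commuting positive elements is positive. The
  usual proof takes a square root of \<open>1 - w\<close>, which need not exist in the
  algebra.\<close>

lemma upb_commuting_square:
  assumes "star g = g" "star w = w" "p w \<le> 1" "w * g = g * w"
  shows "upb (- ((1 - w) * (g * g))) 0"
proof (rule upb_lim)
  fix e :: real assume e: "e > 0"
  have "(\<lambda>J. 2 * p (g * g) / 2 ^ J) \<longlonglongrightarrow> 0"
    by (rule LIMSEQ_divide_realpow_zero) simp
  then have "\<forall>\<^sub>F J in sequentially. 2 * p (g * g) / 2 ^ J < e"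
    using e by (rule order_tendstoD)
  then obtain J where "2 * p (g * g) / 2 ^ J < e" by (auto simp: eventually_sequentially)
  then show "upb (- ((1 - w) * (g * g))) (0 + e)"
    using upb_commuting_square_approx[OF assms, of J] by (auto intro: upb_mono)
qed

section \<open>Cauchy estimates: from spectral bounds back to the norm\<close>

lemma power_scal_expansion:
  fixes g :: 'z
  obtains c where "\<And>\<zeta>. (scal T + \<zeta> *\<^sub>C g) ^ N = (\<Sum>k\<le>N. \<zeta> ^ k *\<^sub>C c k)"
    "N > 0 \<Longrightarrow> c 1 = complex_of_real (real N * T ^ (N - 1)) *\<^sub>C g"
    "c 0 = scal (T ^ N)"
proof -
  have "\<exists>c. (\<forall>\<zeta>. (scal T + \<zeta> *\<^sub>C g) ^ N = (\<Sum>k\<le>N. \<zeta> ^ k *\<^sub>C c k)) \<and>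
    (N > 0 \<longrightarrow> c 1 = complex_of_real (real N * T ^ (N - 1)) *\<^sub>C g) \<and> c 0 = scal (T ^ N)"
  proof (induction N)
    case 0
    show ?case by (rule exI[of _ "\<lambda>_. 1"]) (simp add: scaleC_one)
  next
    case (Suc N)
    then obtain c where c: "\<And>\<zeta>. (scal T + \<zeta> *\<^sub>C g) ^ N = (\<Sum>k\<le>N. \<zeta> ^ k *\<^sub>C c k)"
      "N > 0 \<Longrightarrow> c 1 = complex_of_real (real N * T ^ (N - 1)) *\<^sub>C g" "c 0 = scal (T ^ N)"
      by blast
    \<comment> \<open>Multiplication by the linear factor gives the recursion
      \<open>d k = T c k + g c (k - 1)\<close>, with coefficients outside the range read as 0. The
      value of \<open>c 0\<close> is carried along because it enters the recursion for the linear
      coefficient.\<close>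
    define d where "d k = (if k \<le> N then complex_of_real T *\<^sub>C c k else 0) + (case k of 0 \<Rightarrow> 0 | Suc j \<Rightarrow> g * c j)" for k
    have "(scal T + \<zeta> *\<^sub>C g) ^ Suc N = (\<Sum>k\<le>Suc N. \<zeta> ^ k *\<^sub>C d k)" for \<zeta>
    proof -
      have "(\<Sum>k\<le>Suc N. \<zeta> ^ k *\<^sub>C d k) =
         (\<Sum>k\<le>Suc N. \<zeta> ^ k *\<^sub>C (if k \<le> N then complex_of_real T *\<^sub>C c k else 0)) +
         (\<Sum>k\<le>Suc N. \<zeta> ^ k *\<^sub>C (case k of 0 \<Rightarrow> 0 | Suc j \<Rightarrow> g * c j))"
        by (simp add: d_def scaleC_add_right sum.distrib)
      also have "(\<Sum>k\<le>Suc N. \<zeta> ^ k *\<^sub>C (if k \<le> N then complex_of_real T *\<^sub>C c k else 0)) = scal T * (\<Sum>k\<le>N. \<zeta> ^ k *\<^sub>C c k)"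
        by (simp add: scal_mult cvs.scale_sum_right scaleC_scaleC mult.commute)
      also have "(\<Sum>k\<le>Suc N. \<zeta> ^ k *\<^sub>C (case k of 0 \<Rightarrow> 0 | Suc j \<Rightarrow> g * c j)) = (\<zeta> *\<^sub>C g) * (\<Sum>k\<le>N. \<zeta> ^ k *\<^sub>C c k)"
        by (subst sum.atMost_Suc_shift) (simp add: sum_distrib_left mult_scaleC_left mult_scaleC_right scaleC_scaleC
           cvs.scale_sum_right mult.commute)
      finally show ?thesis by (simp add: c(1) distrib_right)
    qed
    moreover have "d 1 = complex_of_real (real (Suc N) * T ^ (Suc N - 1)) *\<^sub>C g"
    proof (cases "N = 0")
      case True
      then show ?thesis by (simp add: d_def c(3) scaleC_one)
    next
      case False
      then have "d 1 = complex_of_real T *\<^sub>C (complex_of_real (real N * T ^ (N - 1)) *\<^sub>C g)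
          + complex_of_real (T ^ N) *\<^sub>C g"
        using c(2) by (simp add: d_def c(3) mult_scaleC_right)
      also have "\<dots> = complex_of_real (T * (real N * T ^ (N - 1)) + T ^ N) *\<^sub>C g"
        by (simp only: scaleC_scaleC scaleC_add_left of_real_mult of_real_add)
      also have "T * (real N * T ^ (N - 1)) + T ^ N = real (Suc N) * T ^ (Suc N - 1)"
        using False by (cases N) (auto simp: algebra_simps)
      finally show ?thesis .
    qed
    moreover have "d 0 = scal (T ^ Suc N)" by (simp add: d_def c scaleC_scaleC)
    ultimately show ?case by blast
  qed
  then show ?thesis using that by blast
qed

text \<open>Averaging over roots of unity replaces the contour integral and isolates the linear coefficient.\<close>

lemma cauchy_estimate:
  assumes "\<And>\<zeta>. cmod \<zeta> = 1 \<Longrightarrow> p (scal T + \<zeta> *\<^sub>C g) \<le> R" and "N > 0" "T \<ge> 0"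
  shows "real N * T ^ (N - 1) * p g \<le> R ^ N"
proof -
  obtain c where c: "\<And>\<zeta>. (scal T + \<zeta> *\<^sub>C g) ^ N = (\<Sum>k\<le>N. \<zeta> ^ k *\<^sub>C c k)"
    "c 1 = complex_of_real (real N * T ^ (N - 1)) *\<^sub>C g"
    using power_scal_expansion[of T g N] assms(2) by metis
  \<comment> \<open>The exponents \<open>k - 1\<close> with \<open>k \<le> N\<close> range over N +
    1 consecutive integers, so among them only 0 is divisible by M and the average isolates
    \<open>k = 1\<close>.\<close>
  define M where "M = N + 1"
  define \<omega> where "\<omega> = cis (2 * pi / M)"
  have M: "M > 1" using assms by (simp add: M_def)
  have om: "\<omega> ^ M = 1" "cmod \<omega> = 1" "\<omega> \<noteq> 0"
    using M by (auto simp: \<omega>_def Complex.DeMoivre)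
  have prim: "\<omega> ^ k \<noteq> 1" if "0 < k" "k < M" for k
  proof
    assume "\<omega> ^ k = 1"
    then have "cis (2 * pi * k / M) = 1" by (simp add: \<omega>_def Complex.DeMoivre mult_ac)
    then have "cos (2 * pi * k / M) = 1" by (simp add: complex_eq_iff)
    then obtain n :: int where n: "2 * pi * k / M = n * 2 * pi"
      unfolding cos_one_2pi_int by auto
    then have "real k = n * real M" using M by (simp add: field_simps)
    then have "int k = n * int M" by (metis of_int_eq_iff of_int_mult of_int_of_nat_eq)
    with that show False
      by (metis dvd_triv_right int_dvd_int_iff nat_dvd_not_less)
  qed
  have geo: "(\<Sum>j<M. inverse (\<omega> ^ j) * (\<omega> ^ j) ^ k) = (if k = 1 then of_nat M else 0)" if "k \<le> N" for k
  proof -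
    define q where "q = inverse \<omega> * \<omega> ^ k"
    have "(\<Sum>j<M. inverse (\<omega> ^ j) * (\<omega> ^ j) ^ k) = (\<Sum>j<M. q ^ j)"
      by (simp add: q_def power_mult_distrib power_inverse mult.commute flip: power_mult)
    moreover have "q ^ M = 1"
      using om by (simp add: q_def power_mult_distrib power_inverse) (metis mult.commute power_mult power_one)
    moreover have "q \<noteq> 1" if "k \<noteq> 1"
    proof (cases k)
      case 0
      then show ?thesis using prim[of 1] M by (auto simp: q_def)
    next
      case (Suc l)
      then have "q = \<omega> ^ l" using om by (simp add: q_def)
      then show ?thesis using prim[of l] Suc \<open>k \<le> N\<close> that by (auto simp: M_def)
    qed
    moreover have "q = 1" if "k = 1" using that om by (simp add: q_def)
    ultimately show ?thesis by (auto simp: sum_gp_strict)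
  qed
  have "(\<Sum>j<M. inverse (\<omega> ^ j) *\<^sub>C (scal T + \<omega> ^ j *\<^sub>C g) ^ N) =
     (\<Sum>k\<le>N. (\<Sum>j<M. inverse (\<omega> ^ j) * (\<omega> ^ j) ^ k) *\<^sub>C c k)"
    unfolding c(1) cvs.scale_sum_right scaleC_scaleC cvs.scale_sum_left by (rule sum.swap)
  also have "\<dots> = (\<Sum>k\<le>N. if k = 1 then of_nat M *\<^sub>C c k else 0)"
    by (intro sum.cong) (auto simp: geo)
  also have "\<dots> = of_nat M *\<^sub>C c 1" using assms by (simp add: sum.delta)
  finally have eq: "of_nat M *\<^sub>C c 1 = (\<Sum>j<M. inverse (\<omega> ^ j) *\<^sub>C (scal T + \<omega> ^ j *\<^sub>C g) ^ N)" ..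
  have "real M * p (c 1) = p (of_nat M *\<^sub>C c 1)" by (simp add: scale)
  also have "\<dots> \<le> (\<Sum>j<M. p (inverse (\<omega> ^ j) *\<^sub>C (scal T + \<omega> ^ j *\<^sub>C g) ^ N))"
    unfolding eq by (rule sum_le)
  also have "\<dots> \<le> (\<Sum>j<M. R ^ N)"
  proof (rule sum_mono)
    fix j
    have "p ((scal T + \<omega> ^ j *\<^sub>C g) ^ N) \<le> p (scal T + \<omega> ^ j *\<^sub>C g) ^ N" by (rule power_le)
    also have "\<dots> \<le> R ^ N" by (intro power_mono assms(1) nonneg) (simp add: norm_power om)
    finally show "p (inverse (\<omega> ^ j) *\<^sub>C (scal T + \<omega> ^ j *\<^sub>C g) ^ N) \<le> R ^ N"
      by (simp add: scale norm_inverse norm_power om)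
  qed
  finally have "real M * p (c 1) \<le> real M * R ^ N" by simp
  then have "p (c 1) \<le> R ^ N" using M by simp
  then show ?thesis unfolding c(2) using assms by (simp add: scale norm_mult norm_power)
qed

text \<open>The real part of \<zeta> is reached by convex combinations of \<open>scal T\<close> with
  \<open>scal T + g\<close> or \<open>scal T - g\<close>. The imaginary part is nearly free: for
  \<open>z = T + i c g\<close> one has \<open>star z * z = T^2 + c^2 g^2\<close>, so it raises the
  norm by a term of order 1/T only. Each part uses half of the shift.\<close>

lemma upb_circle:
  assumes g: "star g = g" and u: "upb g m" "upb (- g) m" and "m \<ge> 0" "e > 0"
  obtains T0 where "\<And>T \<zeta>. T \<ge> T0 \<Longrightarrow> cmod \<zeta> = 1 \<Longrightarrow> p (scal T + \<zeta> *\<^sub>C g) \<le> T + m + e"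
proof -
  have e: "e/2 > 0" using assms by simp
  obtain T1 where T1: "\<And>T. T \<ge> T1 \<Longrightarrow> p (scal T + g) \<le> T + m + e/2"
    using u(1) e unfolding upb_def by blast
  obtain T2 where T2: "\<And>T. T \<ge> T2 \<Longrightarrow> p (scal T + - g) \<le> T + m + e/2"
    using u(2) e unfolding upb_def by blast
  have scal_split: "scal T = complex_of_real c *\<^sub>C scal T + (scal ((1 - c) * T) :: 'z)" for T c
  proof -
    have "complex_of_real c *\<^sub>C scal T + scal ((1 - c) * T) = (scal (c * T + (1 - c) * T) :: 'z)"
      by (simp only: scaleC_scaleC scaleC_add_left of_real_mult of_real_add)
    then show ?thesis by (simp add: left_diff_distrib)
  qed
  have split: "scal T + complex_of_real c *\<^sub>C x = complex_of_real c *\<^sub>C (scal T + x) + scal ((1 - c) * T)"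
    for T c and x :: 'z
    by (subst scal_split[of T c]) (simp only: scaleC_add_right add_ac)
  have re0: "p (scal T + complex_of_real c *\<^sub>C x) \<le> T + m + e/2"
    if T: "T \<ge> 0" and c: "0 \<le> c" "c \<le> 1" and x: "p (scal T + x) \<le> T + m + e/2" for T c and x :: 'z
  proof -
    have "p (scal T + complex_of_real c *\<^sub>C x) \<le> p (complex_of_real c *\<^sub>C (scal T + x)) + p (scal ((1 - c) * T))"
      unfolding split by (rule add_le)
    also have "\<dots> \<le> c * p (scal T + x) + (1 - c) * T"
      using c T scal_le[of "(1 - c) * T"] by (simp only: scale) simp
    also have "\<dots> \<le> c * (T + m + e/2) + (1 - c) * T"
      using c x by (intro add_right_mono mult_left_mono) auto
    also have "\<dots> = T + c * (m + e/2)" by (simp add: algebra_simps)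
    also have "c * (m + e/2) \<le> 1 * (m + e/2)"
      using assms c by (intro mult_right_mono) auto
    finally show ?thesis by simp
  qed
  have re: "p (scal T + complex_of_real c *\<^sub>C g) \<le> T + m + e/2"
    if T: "T \<ge> max 0 (max T1 T2)" and c: "\<bar>c\<bar> \<le> 1" for T c
  proof (cases "c \<ge> 0")
    case True
    then show ?thesis using T c by (intro re0 T1) auto
  next
    case False
    then have "p (scal T + complex_of_real (- c) *\<^sub>C (- g)) \<le> T + m + e/2"
      using T c by (intro re0 T2) auto
    then show ?thesis by simp
  qed
  have im: "p (scal T + (\<i> * complex_of_real c) *\<^sub>C g) \<le> T + e/2"
    if T: "T \<ge> max 1 ((p g)\<^sup>2 / e)" and c: "\<bar>c\<bar> \<le> 1" for T c
  proof -
    define z where "z = scal T + (\<i> * complex_of_real c) *\<^sub>C g"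
    have sz: "star z = scal T - (\<i> * complex_of_real c) *\<^sub>C g"
      by (simp add: z_def star_simps g)
    have "star z * z = scal (T * T) + complex_of_real (c * c) *\<^sub>C (g * g)"
      by (subst sz) (simp add: z_def left_diff_distrib distrib_left distrib_right mult_scaleC_left
          mult_scaleC_right scaleC_scaleC scaleC_add_right cvs.scale_right_diff_distrib mult_ac)
    then have "(p z)\<^sup>2 = p (scal (T * T) + complex_of_real (c * c) *\<^sub>C (g * g))"
      using star_self[of z] by simp
    also have "\<dots> \<le> T * T + c * c * (p g)\<^sup>2"
      using add_le[of "scal (T * T)" "complex_of_real (c * c) *\<^sub>C (g * g)"] scal_le[of "T * T"]
        mult_left_mono[OF mult_le[of g g], of "c * c"]
      by (simp add: scale norm_mult power2_eq_square abs_mult_self)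
    also have "c * c * (p g)\<^sup>2 \<le> 1 * (p g)\<^sup>2"
      using c by (intro mult_right_mono) (auto simp: abs_le_square_iff[of c 1, simplified] simp flip: power2_eq_square)
    also have "T * T + 1 * (p g)\<^sup>2 \<le> (T + e/2)\<^sup>2"
    proof -
      have "(p g)\<^sup>2 \<le> T * e" using T assms(5) by (simp add: pos_divide_le_eq)
      moreover have "(T + e/2)\<^sup>2 = T * T + T * e + (e/2)\<^sup>2"
        by (simp add: power2_eq_square algebra_simps)
      ultimately show ?thesis using zero_le_power2[of "e/2"] by linarith
    qed
    finally have "p z \<le> T + e/2"
      using T e by (intro power2_le_imp_le[of "p z"]) auto
    then show ?thesis by (simp add: z_def)
  qed
  show ?thesis
  proof (rule that)
    fix T \<zeta> assume T: "T \<ge> 2 * max (max 0 (max T1 T2)) (max 1 ((p g)\<^sup>2 / e))" and z: "cmod \<zeta> = 1"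
    then have T': "T/2 \<ge> max 0 (max T1 T2)" "T/2 \<ge> max 1 ((p g)\<^sup>2 / e)"
      using max.cobounded1[of "max 0 (max T1 T2)" "max 1 ((p g)\<^sup>2 / e)"]
        max.cobounded2[of "max 1 ((p g)\<^sup>2 / e)" "max 0 (max T1 T2)"] by linarith+
    have "scal T = scal (T/2) + (scal (T/2) :: 'z)"
      by (simp flip: scaleC_add_left of_real_add)
    moreover have "\<zeta> *\<^sub>C g = complex_of_real (Re \<zeta>) *\<^sub>C g + (\<i> * complex_of_real (Im \<zeta>)) *\<^sub>C g"
      by (simp flip: scaleC_add_left complex_eq)
    ultimately have "p (scal T + \<zeta> *\<^sub>C g) \<le> p (scal (T/2) + complex_of_real (Re \<zeta>) *\<^sub>C g)
        + p (scal (T/2) + (\<i> * complex_of_real (Im \<zeta>)) *\<^sub>C g)"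
      using add_le[of "scal (T/2) + complex_of_real (Re \<zeta>) *\<^sub>C g" "scal (T/2) + (\<i> * complex_of_real (Im \<zeta>)) *\<^sub>C g"]
      by (simp add: algebra_simps)
    also have "\<dots> \<le> (T/2 + m + e/2) + (T/2 + e/2)"
      using z abs_Re_le_cmod[of \<zeta>] abs_Im_le_cmod[of \<zeta>] by (intro add_mono re im T') auto
    finally show "p (scal T + \<zeta> *\<^sub>C g) \<le> T + m + e" by simp
  qed
qed

text \<open>The hypotheses confine the spectrum of g to the interval from -m to m, and a norm bound
  proportional to m is to be recovered. The Cauchy estimate gives
  \<open>p g \<le> (T / N) * (1 + r / T) ^ N\<close>.\<close>

lemma upb_imp_p_le:
  assumes g: "star g = g" and u: "upb g m" "upb (- g) m" and m: "m > 0"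
  shows "p g \<le> 2 * exp 2 * m"
proof -
  \<comment> \<open>The bound m plus a slack of the same size; the slack is positive because m
    is.\<close>
  define r where "r = 2 * m"
  have r: "r > 0" using m by (simp add: r_def)
  obtain T0 where T0: "\<And>T \<zeta>. T \<ge> T0 \<Longrightarrow> cmod \<zeta> = 1 \<Longrightarrow> p (scal T + \<zeta> *\<^sub>C g) \<le> T + r"
    by (rule upb_circle[OF g u, of m]) (use m in \<open>auto simp: r_def add.assoc\<close>)
  define T where "T = max r T0"
  \<comment> \<open>This balances the two factors of the estimate: \<open>T / N\<close> is at most
    r, and \<open>N * (r / T)\<close> is at most 2 because \<open>T \<ge> r\<close>.\<close>
  define N where "N = nat \<lceil>T / r\<rceil>"
  have T: "T \<ge> r" "T > 0" "T \<ge> T0" using r by (auto simp: T_def)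
  have N: "N > 0" "T / r \<le> N" "N \<le> T / r + 1"
    using T r by (auto simp: N_def)
  have "real N * T ^ (N - 1) * p g \<le> (T + r) ^ N"
    using T N T0 by (intro cauchy_estimate) auto
  then have "real N * T ^ (N - 1) * p g * T \<le> (T + r) ^ N * T"
    using T by (intro mult_right_mono) auto
  also have "real N * T ^ (N - 1) * p g * T = real N * p g * T ^ N"
    using N by (cases N) auto
  also have "(T + r) ^ N * T = (1 + r / T) ^ N * T ^ N * T"
    using T by (simp add: power_mult_distrib[symmetric] field_simps)
  finally have "real N * p g \<le> (1 + r / T) ^ N * T" using T by (simp add: mult_ac)
  also have "(1 + r / T) ^ N \<le> exp (r / T) ^ N"
    using r T by (intro power_mono) (auto simp: exp_ge_add_one_self)
  also have "exp (r / T) ^ N = exp (N * (r / T))" by (rule exp_of_nat_mult[symmetric])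
  also have "\<dots> \<le> exp 2"
  proof -
    have "N * (r / T) \<le> (T / r + 1) * (r / T)" using N r T by (intro mult_right_mono) auto
    also have "\<dots> \<le> 2" using r T by (simp add: field_simps)
    finally show ?thesis by simp
  qed
  finally have "real N * p g \<le> exp 2 * T" using T by simp
  also have "\<dots> \<le> exp 2 * (r * N)" using N r by (intro mult_left_mono) (auto simp: field_simps)
  finally have "real N * p g \<le> real N * (exp 2 * r)" by (simp add: mult_ac)
  then show ?thesis using N by (simp add: r_def)
qed

section \<open>Positivity of star x * x\<close>

lemma of_nat_mult_scaleC: "of_nat n * x = complex_of_real (real n) *\<^sub>C (x :: 'z)"
  by (induction n) (auto simp: algebra_simps scaleC_add_left scaleC_one)

text \<open>Since \<open>p h \<le> T\<close>, the element v is morally positive. For even j the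
  product is the square of a hermitian element; for odd j one factor v remains, and it is T times
  \<open>1 - w\<close> with the contraction \<open>w = h / T\<close>.\<close>

lemma upb_power_mult_square:
  assumes h: "star h = h" "p h \<le> T" and T: "T > 0"
  defines "v \<equiv> scal T - h"
  shows "upb (- (v ^ j * ((v - 1) * (v - 1)))) 0"
proof -
  have sv: "star v = v" by (simp add: v_def star_simps h)
  define i where "i = j div 2"
  define g where "g = v ^ i * (v - 1)"
  have comm: "v ^ i * (v - 1) = (v - 1) * v ^ i" by (simp add: algebra_simps power_commutes)
  have sg: "star g = g" by (simp add: g_def star_simps sv comm)
  have gg: "g * g = v ^ (i + i) * ((v - 1) * (v - 1))"
    unfolding g_def power_add by (metis comm mult.assoc)
  show ?thesis
  proof (cases "even j")
    case True
    then have "j = i + i" unfolding i_def by presburger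
    then show ?thesis using upb_herm_square[OF sg] gg by simp
  next
    case False
    then have j: "j = Suc (i + i)" unfolding i_def by presburger
    define w where "w = complex_of_real (1 / T) *\<^sub>C h"
    have w: "star w = w" "p w \<le> 1" using h T by (auto simp: w_def star_simps scale norm_divide divide_simps)
    have vw: "v = complex_of_real T *\<^sub>C (1 - w)"
      using T by (simp add: v_def w_def cvs.scale_right_diff_distrib scaleC_scaleC scaleC_one)
    have vg: "v * g = g * v" unfolding g_def by (simp add: algebra_simps power_commutes)
    have wv: "w = 1 - complex_of_real (1 / T) *\<^sub>C v"
      using T by (simp add: vw scaleC_scaleC scaleC_one)
    have "w * g = g * w"
      unfolding wv by (simp add: left_diff_distrib right_diff_distrib mult_scaleC_left mult_scaleC_right vg)
    from upb_scale[OF upb_commuting_square[OF sg w this], of T] T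
    have "upb (complex_of_real T *\<^sub>C (- ((1 - w) * (g * g)))) 0" by simp
    also have "complex_of_real T *\<^sub>C (- ((1 - w) * (g * g))) = - (v * (g * g))"
      by (simp add: vw mult_scaleC_left)
    finally show ?thesis by (simp add: gg j mult.assoc)
  qed
qed

text \<open>As a polynomial in v the left side has a double zero at 1; dividing by
  \<open>(v - 1)^2\<close> leaves the positive coefficients \<open>j + 1\<close>.\<close>

lemma power_tangent_identity:
  "1 + of_nat n * v ^ Suc n - of_nat (Suc n) * v ^ n =
    (\<Sum>j<n. of_nat (Suc j) * (v ^ j * ((v - 1) * (v - 1)) :: 'z))"
proof (induction n)
  case (Suc n)
  have "1 + (m + 1) * (X * v * v) - (1 + (1 + m)) * (X * v) =
      1 + m * (X * v) - (1 + m) * X + (1 + m) * (X * ((v - 1) * (v - 1)))" for m X :: 'z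
    by (simp add: algebra_simps)
  from this[of "of_nat n" "v ^ n"] show ?case
    unfolding sum.lessThan_Suc Suc.IH[symmetric] power_Suc2 by (simp add: add.commute)
qed simp

text \<open>With \<open>T = 1 + 1/n\<close> and \<open>v = T - h\<close>, the element is
  \<open>(n + 1) v^n - n v^(n+1)\<close>. As a function of real \<open>v \<ge> 0\<close> this has
  its maximum 1 at \<open>v = 1\<close>; T is chosen to put the peak there. The tangent identity
  writes 1 minus the element as a sum of terms already known to be positive.\<close>

lemma upb_peak:
  assumes h: "star h = h" "p h \<le> 1" and n: "n > 0"
  shows "upb (of_nat n * (h * (scal (1 + 1 / real n) - h) ^ n)) 1"
proof -
  define T where "T = 1 + 1 / real n"
  define v where "v = scal T - h"
  have T: "T \<ge> 1" by (simp add: T_def)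
  have nT: "of_nat n * scal T = (of_nat (Suc n) :: 'z)"
  proof -
    have "real n * T = real (Suc n)" using n by (simp add: T_def field_simps)
    then have "of_nat n * scal T = (scal (real (Suc n)) :: 'z)"
      by (simp only: of_nat_mult_scaleC scaleC_scaleC flip: of_real_mult)
    also have "\<dots> = of_nat (Suc n)" by (simp only: of_nat_mult_scaleC[symmetric] mult_1_right)
    finally show ?thesis .
  qed
  have hv: "h = scal T - v" by (simp add: v_def)
  have "of_nat n * (h * v ^ n) = (of_nat n * scal T) * v ^ n - of_nat n * v ^ Suc n"
    by (simp add: hv algebra_simps)
  also have "\<dots> = 1 - (\<Sum>j<n. of_nat (Suc j) * (v ^ j * ((v - 1) * (v - 1))))"
    unfolding nT power_tangent_identity[symmetric] by simp
  finally have eq: "of_nat n * (h * v ^ n) =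
      scal 1 + (\<Sum>j<n. complex_of_real (real (Suc j)) *\<^sub>C (- (v ^ j * ((v - 1) * (v - 1)))))"
    by (simp only: of_nat_mult_scaleC) (simp add: scaleC_one sum_negf)
  have "upb (scal 1 + (\<Sum>j<n. complex_of_real (real (Suc j)) *\<^sub>C (- (v ^ j * ((v - 1) * (v - 1))))))
     (1 + (\<Sum>j<n. real (Suc j) * 0))"
    unfolding v_def using h T
    by (intro upb_add upb_scal upb_sum upb_scale upb_power_mult_square) auto
  then show ?thesis unfolding eq[symmetric] by (simp add: v_def T_def)
qed

lemma upb_star_self_add:
  "upb (- (star y * y + y * star y)) 0"
proof -
  define a where "a = complex_of_real (1/2) *\<^sub>C (y + star y)"
  define b where "b = (\<i> / 2) *\<^sub>C (star y - y)"
  have s: "star a = a" "star b = b"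
    by (simp_all add: a_def b_def star_simps add.commute cvs.scale_right_diff_distrib)
  have "a * a + b * b = complex_of_real (1/2) *\<^sub>C (star y * y + y * star y)"
  proof -
    have "a * a = (1/4) *\<^sub>C ((y + star y) * (y + star y))"
      "b * b = (1/4) *\<^sub>C (- ((star y - y) * (star y - y)))"
      by (simp_all add: a_def b_def mult_scaleC_left mult_scaleC_right scaleC_scaleC)
    then have "a * a + b * b = (1/4) *\<^sub>C ((y + star y) * (y + star y) + - ((star y - y) * (star y - y)))"
      by (simp only: scaleC_add_right)
    also have "(y + star y) * (y + star y) + - ((star y - y) * (star y - y)) =
       2 *\<^sub>C (star y * y + y * star y)"
      by (simp add: scaleC_two algebra_simps)
    finally show ?thesis by (simp add: scaleC_scaleC)
  qed
  then have "complex_of_real 2 *\<^sub>C (a * a + b * b) = star y * y + y * star y"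
    by (simp add: scaleC_scaleC scaleC_one)
  then have "complex_of_real 2 *\<^sub>C (- (a * a) + - (b * b)) = - (star y * y + y * star y)"
    by (simp only: minus_add_distrib[symmetric] cvs.scale_minus_right)
  moreover have "upb (complex_of_real 2 *\<^sub>C (- (a * a) + - (b * b))) (2 * (0 + 0))"
    by (intro upb_scale upb_add upb_herm_square s) auto
  ultimately show ?thesis by simp
qed

text \<open>Kaplansky's argument.  If \<open>h = x\<^sup>*x\<close> had a negative part, then so would
  \<open>y\<^sup>*y = h v\<^sup>n\<close> with \<open>y = x v\<^bsup>n/2\<^esup>\<close>, while its positive part is of size \<open>1/n\<close>; the same bound for
  \<open>yy\<^sup>* = k v\<^sup>n\<close> and the positivity of \<open>y\<^sup>*y + yy\<^sup>* = 2 (Re y)\<^sup>2 + 2 (Im y)\<^sup>2\<close> exclude this for large \<open>n\<close>.\<close>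

lemma upb_star_self_contraction:
  assumes x: "p x \<le> 1"
  shows "upb (- (star x * x)) 0"
proof (rule ccontr)
  define h where "h = star x * x"
  define k where "k = x * star x"
  have s: "star h = h" "star k = k" by (simp_all add: h_def k_def star_simps)
  have hk: "p h \<le> 1" "p k \<le> 1"
    using x nonneg[of x] star_self[of x] star_self[of "star x"]
    by (simp_all add: h_def k_def p_star star_star power_le_one)
  assume "\<not> upb (- (star x * x)) 0"
  then obtain e where e: "e > 0" "\<And>T0. \<exists>T\<ge>T0. \<not> p (scal T + - h) \<le> T + e"
    by (auto simp: upb_def h_def)
  \<comment> \<open>The failure is known only for arbitrarily large T; monotonicity in T extends it
    to every T, in particular to the T close to 1 used below.\<close>
  have big: "p (scal T - h) > T + e" for T
    using e(2)[of T] upb_antimono[of T "- h" e] by force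
  have key: "real n * e \<le> 2 * exp 2" if n: "n = 2 * N" "N > 0" for n N
  proof -
    define T where "T = 1 + 1 / real n"
    have T: "T \<ge> 1" by (simp add: T_def)
    define v where "v = scal T - h"
    define v' where "v' = scal T - k"
    have sv: "star v = v" by (simp add: v_def star_simps s)
    define y where "y = x * v ^ N"
    have hv: "h * v = v * h" by (simp add: v_def algebra_simps mult_scaleC_left mult_scaleC_right)
    have hvn: "h * v ^ m = v ^ m * h" for m
      by (induction m) (auto simp: mult.assoc, metis hv mult.assoc)
    \<comment> \<open>The intertwining relation \<open>x f(h) = f(k) x\<close>, which moves the
      power of v past x and expresses \<open>y * star y\<close> through k.\<close>
    have xv: "x * v ^ m = v' ^ m * x" for m
    proof (induction m)
      case (Suc m)
      have "x * v = v' * x" by (simp add: v_def v'_def h_def k_def algebra_simps mult_scaleC_left mult_scaleC_right)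
      then show ?case using Suc by (metis mult.assoc power_Suc power_Suc2)
    qed simp
    have y1: "star y * y = h * v ^ n"
    proof -
      have "star y * y = v ^ N * h * v ^ N" by (simp add: y_def star_simps sv h_def mult.assoc)
      also have "\<dots> = h * (v ^ N * v ^ N)" by (metis hvn mult.assoc)
      finally show ?thesis by (simp add: n mult_2 power_add)
    qed
    have y2: "y * star y = k * v' ^ n"
    proof -
      have "y * star y = x * (v ^ N * v ^ N) * star x" by (simp add: y_def star_simps sv mult.assoc)
      also have "\<dots> = x * v ^ n * star x" by (simp add: n mult_2 power_add)
      also have "\<dots> = v' ^ n * k" unfolding xv k_def by (simp add: mult.assoc)
      also have "\<dots> = k * v' ^ n"
      proof -
        have "k * v' = v' * k" by (simp add: v'_def algebra_simps mult_scaleC_left mult_scaleC_right)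
        then have "k * v' ^ m = v' ^ m * k" for m
          by (induction m) (auto simp: mult.assoc, metis mult.assoc)
        then show ?thesis by simp
      qed
      finally show ?thesis .
    qed
    have n0: "n > 0" using n by simp
    define r where "r = of_nat n * (star y * y)"
    have u1: "upb r 1"
      unfolding r_def y1 v_def T_def by (rule upb_peak[OF s(1) hk(1) n0])
    have "upb (of_nat n * (y * star y)) 1"
      unfolding y2 v'_def T_def by (rule upb_peak[OF s(2) hk(2) n0])
    moreover have "upb (complex_of_real (real n) *\<^sub>C (- (star y * y + y * star y))) (real n * 0)"
      by (intro upb_scale upb_star_self_add) auto
    ultimately have "upb (of_nat n * (y * star y) + of_nat n * (- (star y * y + y * star y))) (1 + real n * 0)"
      unfolding of_nat_mult_scaleC by (intro upb_add)
    \<comment> \<open>Here \<open>- r\<close> is \<open>n * (y * star y)\<close>, bounded by 1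
      through the peak estimate for k, minus n times the positive sum of both products.\<close>
    then have u2: "upb (- r) 1" by (simp add: r_def algebra_simps)
    have "star r = r" by (simp add: r_def of_nat_mult_scaleC star_simps)
    from upb_imp_p_le[OF this u1 u2] have "p r \<le> 2 * exp 2" by simp
    moreover have "p r = real n * p (h * v ^ n)"
      by (simp add: r_def of_nat_mult_scaleC scale y1)
    \<comment> \<open>Because \<open>h * v^n = T v^n - v^(n+1)\<close> and norms of powers of the
      hermitian v are exact, the norm is at least \<open>L^n * (L - T)\<close>, where L exceeds both
      1 and \<open>T + e\<close>. The lower bound e is thus uniform in n, while \<open>p r\<close>
      stays bounded.\<close>
    moreover have "p (h * v ^ n) \<ge> e"
    proof -
      define L where "L = p v"
      have L: "L > T + e" using big by (simp add: L_def v_def)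
      have hv': "h = scal T - v" by (simp add: v_def)
      have "v ^ Suc n = complex_of_real T *\<^sub>C v ^ n - h * v ^ n"
        by (simp add: hv' algebra_simps mult_scaleC_left)
      then have "p (v ^ Suc n) \<le> p (complex_of_real T *\<^sub>C v ^ n) + p (h * v ^ n)"
        by (simp only: diff_le)
      then have "L ^ Suc n \<le> T * L ^ n + p (h * v ^ n)"
        using T n0 by (simp only: herm_power[OF sv] scale L_def zero_less_Suc) simp
      then have "L ^ n * (L - T) \<le> p (h * v ^ n)" by (simp add: algebra_simps)
      moreover have "1 * e \<le> L ^ n * (L - T)"
        using L T e by (intro mult_mono one_le_power) auto
      ultimately show ?thesis by simp
    qed
    ultimately show ?thesis
      using n0 by (metis mult_left_mono of_nat_0_le_iff order_trans)
  qed
  obtain N :: nat where "real N > 2 * exp 2 / e" using reals_Archimedean2 by blast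
  then have "real N * e > 2 * exp 2" using e(1) by (simp add: field_simps)
  moreover have "real N * e \<le> real (2 * Suc N) * e" using e(1) by (intro mult_right_mono) auto
  ultimately have "real (2 * Suc N) * e > 2 * exp 2" by (rule less_le_trans)
  with key[of "2 * Suc N" "Suc N"] show False by simp
qed

lemma upb_star_self: "upb (- (star x * x)) 0"
proof -
  define t where "t = p x + 1"
  have t: "t > 0" using nonneg[of x] by (simp add: t_def)
  define y where "y = complex_of_real (1/t) *\<^sub>C x"
  have "p y \<le> 1" using t nonneg[of x] by (simp add: y_def scale norm_divide t_def)
  from upb_scale[OF upb_star_self_contraction[OF this], of "t * t"]
  have "upb (complex_of_real (t * t) *\<^sub>C (- (star y * y))) 0" by simp
  also have "complex_of_real (t * t) *\<^sub>C (- (star y * y)) = - (star x * x)"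
    using t by (simp add: y_def star_simps mult_scaleC_left mult_scaleC_right scaleC_scaleC scaleC_one)
  finally show ?thesis .
qed

lemma sum_star_self_bound:
  assumes "finite I" "(\<Sum>i\<in>I. star (y i) * y i) = scal c" "i \<in> I" "c \<ge> 0"
  shows "(p (y i))\<^sup>2 \<le> 2 * exp 2 * (c + 1)"
proof -
  have eq: "star (y i) * y i = scal c + (\<Sum>j\<in>I - {i}. - (star (y j) * y j))"
    unfolding assms(2)[symmetric] using assms(1,3) by (simp add: sum.remove sum_negf)
  have "upb (scal c + (\<Sum>j\<in>I - {i}. - (star (y j) * y j))) (c + (\<Sum>j\<in>I - {i}. 0))"
    using assms(1) by (intro upb_add upb_scal upb_sum upb_star_self) auto
  \<comment> \<open>\<open>c + 1\<close> instead of c, since c may be 0 and the passage from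
    \<open>upb\<close> to the norm asks for a strictly positive bound.\<close>
  then have u1: "upb (star (y i) * y i) (c + 1)" unfolding eq by (auto intro: upb_mono)
  have u2: "upb (- (star (y i) * y i)) (c + 1)"
    using upb_mono[OF upb_star_self] assms(4) by simp
  have "star (star (y i) * y i) = star (y i) * y i" by (simp add: star_simps)
  from upb_imp_p_le[OF this u1 u2] assms(4) show ?thesis by (simp add: star_self)
qed

end

section \<open>Sums of squares and the GNS seminorm\<close>

text \<open>One elimination step: \<open>G\<close> is the Schur complement of the pivot
  \<open>F n n\<close>, and the cross terms of \<open>star y * y\<close> absorb the last row and
  column of F.\<close>

lemma completing_the_square:
  fixes e :: "nat \<Rightarrow> 'z::star_alg" and F :: "nat \<Rightarrow> nat \<Rightarrow> complex"
  assumes herm: "\<And>i j. i < Suc n \<Longrightarrow> j < Suc n \<Longrightarrow> F j i = cnj (F i j)"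
    and d: "F n n = complex_of_real d" "d > 0"
  defines "y \<equiv> e n + (\<Sum>j<n. (F n j / F n n) *\<^sub>C e j)"
    and "G \<equiv> \<lambda>i j. F i j - F i n * F n j / F n n"
  shows "(\<Sum>i<Suc n. \<Sum>j<Suc n. F i j *\<^sub>C (star (e i) * e j)) =
    F n n *\<^sub>C (star y * y) + (\<Sum>i<n. \<Sum>j<n. G i j *\<^sub>C (star (e i) * e j))"
proof -
  have d0: "F n n \<noteq> 0" and dc: "cnj (F n n) = F n n" using d by auto
  have cn: "cnj (F n i) = F i n" if "i < n" for i using herm[of n i] that by simp
  define q where "q = (\<Sum>j<n. (F n j / F n n) *\<^sub>C e j)"
  have sq: "star q = (\<Sum>i<n. (F i n / F n n) *\<^sub>C star (e i))"
    unfolding q_def star_sum by (intro sum.cong) (simp_all add: star_scaleC dc cn)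
  have q1: "F n n *\<^sub>C (star (e n) * q) = (\<Sum>j<n. F n j *\<^sub>C (star (e n) * e j))"
    using d0 by (simp add: q_def sum_distrib_left cvs.scale_sum_right mult_scaleC_right scaleC_scaleC)
  have q2: "F n n *\<^sub>C (star q * e n) = (\<Sum>i<n. F i n *\<^sub>C (star (e i) * e n))"
    using d0 by (simp add: sq sum_distrib_right cvs.scale_sum_right mult_scaleC_left scaleC_scaleC)
  have q3: "F n n *\<^sub>C (star q * q) = (\<Sum>i<n. \<Sum>j<n. (F i n * F n j / F n n) *\<^sub>C (star (e i) * e j))"
    unfolding sq unfolding q_def using d0
    by (simp add: sum_distrib_right sum_distrib_left cvs.scale_sum_right mult_scaleC_left mult_scaleC_right scaleC_scaleC mult_ac)
      (rule sum.swap)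
  have "F n n *\<^sub>C (star y * y) = F n n *\<^sub>C (star (e n) * e n) + F n n *\<^sub>C (star (e n) * q)
      + F n n *\<^sub>C (star q * e n) + F n n *\<^sub>C (star q * q)"
    unfolding y_def q_def[symmetric] by (simp add: star_add distrib_left distrib_right scaleC_add_right add_ac)
  moreover have "(\<Sum>i<n. \<Sum>j<n. G i j *\<^sub>C (star (e i) * e j)) =
      (\<Sum>i<n. \<Sum>j<n. F i j *\<^sub>C (star (e i) * e j)) - F n n *\<^sub>C (star q * q)"
    unfolding q3 by (simp add: G_def cvs.scale_left_diff_distrib sum_subtractf)
  moreover have "(\<Sum>i<Suc n. \<Sum>j<Suc n. F i j *\<^sub>C (star (e i) * e j)) =
     (\<Sum>i<n. \<Sum>j<n. F i j *\<^sub>C (star (e i) * e j)) + F n n *\<^sub>C (star q * e n)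
      + F n n *\<^sub>C (star (e n) * q) + F n n *\<^sub>C (star (e n) * e n)"
    unfolding q1 q2 by (simp add: sum.distrib add_ac)
  ultimately show ?thesis by (simp add: algebra_simps)
qed

lemma posdef_form_sum_of_squares:
  fixes e :: "nat \<Rightarrow> 'z::star_alg" and F :: "nat \<Rightarrow> nat \<Rightarrow> complex"
  assumes herm: "\<And>i j. i < n \<Longrightarrow> j < n \<Longrightarrow> F j i = cnj (F i j)"
    and pos: "\<And>x i. i < n \<Longrightarrow> x i \<noteq> 0 \<Longrightarrow> Re (\<Sum>i<n. \<Sum>j<n. F i j * (cnj (x i) * x j)) > 0"
  shows "\<exists>y. (\<Sum>i<n. \<Sum>j<n. F i j *\<^sub>C (star (e i) * e j)) = (\<Sum>k<n. star (y k) * y k)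
    \<and> e ` {..<n} \<subseteq> cvs.span (y ` {..<n})"
  using assms
proof (induction n arbitrary: F)
  case (Suc n)
  define d where "d = Re (F n n)"
  have "Im (F n n) = 0" using Suc.prems(1)[of n n] by (simp add: complex_eq_iff)
  then have Fd: "F n n = complex_of_real d" by (simp add: d_def complex_eq_iff)
  have "Re (\<Sum>i<Suc n. \<Sum>j<Suc n. F i j * (cnj (of_bool (i = n)) * of_bool (j = n))) > 0"
    by (rule Suc.prems(2)[of n "\<lambda>i. of_bool (i = n)"]) auto
  then have d: "d > 0" by (simp add: d_def sum_distrib_left[symmetric] sum_distrib_right[symmetric])
  define G where "G i j = F i j - F i n * F n j / F n n" for i j
  define y0 where "y0 = e n + (\<Sum>j<n. (F n j / F n n) *\<^sub>C e j)"
  have split: "(\<Sum>i<Suc n. \<Sum>j<Suc n. F i j *\<^sub>C (star (e i) * e j)) =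
    F n n *\<^sub>C (star y0 * y0) + (\<Sum>i<n. \<Sum>j<n. G i j *\<^sub>C (star (e i) * e j))"
    unfolding y0_def G_def by (rule completing_the_square[where F=F and n=n, OF _ Fd d]) (rule Suc.prems(1))
  have "\<exists>y. (\<Sum>i<n. \<Sum>j<n. G i j *\<^sub>C (star (e i) * e j)) = (\<Sum>k<n. star (y k) * y k)
    \<and> e ` {..<n} \<subseteq> cvs.span (y ` {..<n})"
  proof (rule Suc.IH)
    fix i j assume ij: "i < n" "j < n"
    then have "F j i = cnj (F i j)" "F j n = cnj (F n j)" "F n i = cnj (F i n)"
      by (intro Suc.prems(1); simp)+
    then show "G j i = cnj (G i j)" by (simp add: G_def Fd mult.commute)
  next
    fix x :: "nat \<Rightarrow> complex" and i assume i: "i < n" "x i \<noteq> 0"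
    define s where "s = (\<Sum>j<n. F n j * x j)"
    \<comment> \<open>This t minimises the form over the last coordinate. At the minimum the form of
      F takes the value of the form of G on x, so positivity passes to the Schur complement.\<close>
    define t where "t = - s / F n n"
    define x' where "x' j = (if j < n then x j else t)" for j
    have cs: "(\<Sum>i<n. F i n * cnj (x i)) = cnj s"
    proof -
      have "F i n = cnj (F n i)" if "i < n" for i
        by (rule Suc.prems(1)) (use that in auto)
      then show ?thesis by (simp add: s_def)
    qed
    have "0 < Re (\<Sum>i<Suc n. \<Sum>j<Suc n. F i j * (cnj (x' i) * x' j))"
      using i by (intro Suc.prems(2)[of i]) (auto simp: x'_def)
    also have "(\<Sum>i<Suc n. \<Sum>j<Suc n. F i j * (cnj (x' i) * x' j)) =
       (\<Sum>i<n. \<Sum>j<n. F i j * (cnj (x i) * x j)) + (\<Sum>i<n. F i n * cnj (x i)) * t + cnj t * s + F n n * (cnj t * t)"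
      by (simp add: x'_def s_def sum.distrib sum_distrib_left sum_distrib_right mult_ac)
    also have "\<dots> = (\<Sum>i<n. \<Sum>j<n. F i j * (cnj (x i) * x j)) - cnj s * s / F n n"
      unfolding cs using d by (simp add: t_def Fd field_simps)
    also have "\<dots> = (\<Sum>i<n. \<Sum>j<n. G i j * (cnj (x i) * x j))"
      unfolding cs[symmetric] unfolding s_def
      by (simp add: G_def left_diff_distrib right_diff_distrib sum_subtractf sum_distrib_left sum_distrib_right sum_divide_distrib mult_ac)
    finally show "0 < Re (\<Sum>i<n. \<Sum>j<n. G i j * (cnj (x i) * x j))" .
  qed
  then obtain y where y: "(\<Sum>i<n. \<Sum>j<n. G i j *\<^sub>C (star (e i) * e j)) = (\<Sum>k<n. star (y k) * y k)"
    "e ` {..<n} \<subseteq> cvs.span (y ` {..<n})" by blast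
  define y' where "y' k = (if k < n then y k else complex_of_real (sqrt d) *\<^sub>C y0)" for k
  have dd: "complex_of_real (sqrt d) * complex_of_real (sqrt d) = F n n"
    using d by (simp add: Fd flip: of_real_mult)
  have sum: "(\<Sum>k<Suc n. star (y' k) * y' k) = (\<Sum>k<n. star (y k) * y k) + F n n *\<^sub>C (star y0 * y0)"
    by (simp add: y'_def star_scaleC mult_scaleC_left mult_scaleC_right scaleC_scaleC dd)
  have img: "y' ` {..<Suc n} = insert (y' n) (y ` {..<n})"
    by (auto simp: y'_def lessThan_Suc image_iff)
  have sub: "e j \<in> cvs.span (y' ` {..<Suc n})" if "j < n" for j
    using y(2) that cvs.span_mono[of "y ` {..<n}" "y' ` {..<Suc n}"] by (auto simp: img)
  have "y' n \<in> cvs.span (y' ` {..<Suc n})" by (intro cvs.span_base) simp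
  then have "complex_of_real (1 / sqrt d) *\<^sub>C y' n \<in> cvs.span (y' ` {..<Suc n})"
    by (rule cvs.span_scale)
  then have "y0 \<in> cvs.span (y' ` {..<Suc n})"
    using d by (simp add: y'_def scaleC_scaleC scaleC_one)
  then have "y0 - (\<Sum>j<n. (F n j / F n n) *\<^sub>C e j) \<in> cvs.span (y' ` {..<Suc n})"
    by (intro cvs.span_diff cvs.span_sum cvs.span_scale sub) auto
  then have "e n \<in> cvs.span (y' ` {..<Suc n})" by (simp add: y0_def)
  with sub have "e ` {..<Suc n} \<subseteq> cvs.span (y' ` {..<Suc n})" by (auto simp: less_Suc_eq)
  moreover have "(\<Sum>i<Suc n. \<Sum>j<Suc n. F i j *\<^sub>C (star (e i) * e j)) = (\<Sum>k<Suc n. star (y' k) * y' k)"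
    unfolding split y(1) sum by (rule add.commute)
  ultimately show ?case by blast
qed simp

section \<open>The GNS form of a positive functional\<close>

locale positive_form =
  fixes \<mu> :: "'z::star_alg \<Rightarrow> complex"
  assumes lin: "clin \<mu>" and pos: "positive_functional \<mu>"
begin

lemma mu_add: "\<mu> (x + y) = \<mu> x + \<mu> y" and mu_scale: "\<mu> (c *\<^sub>C x) = c * \<mu> x"
  using lin by (auto simp: clin_def scaleC_complex_def)

lemma mu_sum: "\<mu> (sum f A) = (\<Sum>i\<in>A. \<mu> (f i))"
  by (rule clin_sum[OF lin])

lemma mu_nonneg: "Re (\<mu> (star x * x)) \<ge> 0" and mu_real: "Im (\<mu> (star x * x)) = 0"
  using pos by (auto simp: positive_functional_def)

lemma mu_expand: "\<mu> (star (x + c *\<^sub>C y) * (x + c *\<^sub>C y)) =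
    \<mu> (star x * x) + c * \<mu> (star x * y) + cnj c * \<mu> (star y * x) + (cnj c * c) * \<mu> (star y * y)"
  by (simp add: star_add star_scaleC distrib_left distrib_right mult_scaleC_left mult_scaleC_right
      mu_add mu_scale scaleC_scaleC algebra_simps)

text \<open>Polarisation: the values at \<open>x + y\<close> and \<open>x + i y\<close> are real,
  which fixes the imaginary and the real part respectively.\<close>

lemma mu_herm: "\<mu> (star y * x) = cnj (\<mu> (star x * y))"
proof (rule complex_eqI)
  show "Im (\<mu> (star y * x)) = Im (cnj (\<mu> (star x * y)))"
    using mu_real[of "x + 1 *\<^sub>C y"] unfolding mu_expand by (simp add: mu_real)
  show "Re (\<mu> (star y * x)) = Re (cnj (\<mu> (star x * y)))"
    using mu_real[of "x + \<i> *\<^sub>C y"] unfolding mu_expand by (simp add: mu_real)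
qed

definition nrm :: "'z \<Rightarrow> real" where "nrm x = sqrt (Re (\<mu> (star x * x)))"

lemma nrm_nonneg: "nrm x \<ge> 0" and nrm_sq: "(nrm x)\<^sup>2 = Re (\<mu> (star x * x))"
  using mu_nonneg[of x] by (simp_all add: nrm_def)

lemma nrm_scale: "nrm (c *\<^sub>C x) = cmod c * nrm x"
proof -
  have "\<mu> (star (c *\<^sub>C x) * (c *\<^sub>C x)) = complex_of_real ((cmod c)\<^sup>2) * \<mu> (star x * x)"
    unfolding complex_norm_square
    by (simp add: star_scaleC mult_scaleC_left mult_scaleC_right mu_scale)
  then show ?thesis by (simp add: nrm_def real_sqrt_mult)
qed

lemma Cauchy_Schwarz: "cmod (\<mu> (star x * y)) \<le> nrm x * nrm y"
proof -
  define b where "b = \<mu> (star x * y)"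
  define B where "B = Re (\<mu> (star y * y))"
  define A where "A = Re (\<mu> (star x * x))"
  have "0 \<le> A - 2 * t * (cmod b)\<^sup>2 + t\<^sup>2 * (cmod b)\<^sup>2 * B" for t :: real
  proof -
    have *: "b * cnj b = complex_of_real ((cmod b)\<^sup>2)" by (rule complex_norm_square[symmetric])
    have "0 \<le> Re (\<mu> (star (x + (- t * cnj b) *\<^sub>C y) * (x + (- t * cnj b) *\<^sub>C y)))" by (rule mu_nonneg)
    also have "\<mu> (star (x + (- t * cnj b) *\<^sub>C y) * (x + (- t * cnj b) *\<^sub>C y)) =
       \<mu> (star x * x) - 2 * t * (b * cnj b) + t\<^sup>2 * (b * cnj b) * \<mu> (star y * y)"
      unfolding mu_expand mu_herm[of y x] b_def[symmetric] by (simp add: algebra_simps power2_eq_square)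
    finally show ?thesis unfolding * A_def B_def by simp
  qed note quad = this
  have "(cmod b)\<^sup>2 \<le> A * B"
  proof (cases "B = 0")
    case True
    have "b = 0"
    proof (rule ccontr)
      assume "b \<noteq> 0"
      \<comment> \<open>With \<open>B = 0\<close> the quadratic is affine in t, and this t makes it
        negative.\<close>
      then have "0 \<le> A - 2 * (A + 1)" using quad[of "(A + 1) / (cmod b)\<^sup>2"] True by simp
      then show False using mu_nonneg[of x] by (simp add: A_def)
    qed
    then show ?thesis using True by simp
  next
    case False
    then have "B > 0" using mu_nonneg[of y] by (simp add: B_def)
    then show ?thesis using quad[of "1 / B"] by (simp add: field_simps power2_eq_square)
  qed
  then have "(cmod b)\<^sup>2 \<le> (nrm x * nrm y)\<^sup>2" by (simp add: power_mult_distrib nrm_sq A_def B_def)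
  then show ?thesis unfolding b_def by (rule power2_le_imp_le) (simp add: nrm_nonneg)
qed

lemma nrm_triangle: "nrm (x + y) \<le> nrm x + nrm y"
proof -
  have "(nrm (x + y))\<^sup>2 = (nrm x)\<^sup>2 + 2 * Re (\<mu> (star x * y)) + (nrm y)\<^sup>2"
    unfolding nrm_sq using mu_expand[of x 1 y] mu_herm[of y x] by (simp add: scaleC_one)
  also have "\<dots> \<le> (nrm x + nrm y)\<^sup>2"
    using Cauchy_Schwarz[of x y] complex_Re_le_cmod[of "\<mu> (star x * y)"]
    by (simp add: power2_sum)
  finally show ?thesis by (rule power2_le_imp_le) (simp add: nrm_nonneg)
qed

text \<open>These are the elements for which the supremum in \<open>opnorm\<close> is taken over a
  bounded set, so that it is a meaningful operator norm.\<close>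

definition bounded_elts :: "'z set" where
  "bounded_elts = {z. \<exists>K. \<forall>w. nrm (z * w) \<le> K * nrm w}"

lemma subspace_bounded_elts: "cvs.subspace bounded_elts"
proof (rule cvs.subspaceI)
  show "0 \<in> bounded_elts" by (auto simp: bounded_elts_def nrm_def lin clin_0 intro!: exI[of _ 0])
next
  fix x y assume "x \<in> bounded_elts" "y \<in> bounded_elts"
  then obtain K L where "\<And>w. nrm (x * w) \<le> K * nrm w" "\<And>w. nrm (y * w) \<le> L * nrm w"
    by (auto simp: bounded_elts_def)
  then have "nrm ((x + y) * w) \<le> (K + L) * nrm w" for w
    using nrm_triangle[of "x * w" "y * w"] by (simp add: distrib_right) (smt (verit))
  then show "x + y \<in> bounded_elts" by (auto simp: bounded_elts_def)
next
  fix c x assume "x \<in> bounded_elts"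
  then obtain K where K: "\<And>w. nrm (x * w) \<le> K * nrm w" by (auto simp: bounded_elts_def)
  have "nrm ((c *\<^sub>C x) * w) \<le> (cmod c * K) * nrm w" for w
    using mult_left_mono[OF K[of w], of "cmod c"] by (simp add: mult_scaleC_left nrm_scale mult.assoc)
  then show "c *\<^sub>C x \<in> bounded_elts" by (auto simp: bounded_elts_def)
qed

text \<open>Sandwiching the relation between \<open>star w\<close> and w and applying
  \<open>\<mu>\<close> shows that the squares of all \<open>nrm (y j * w)\<close> add up to
  \<open>c * (nrm w)^2\<close>; one of them is at most the sum.\<close>

lemma sum_star_self_bounded_elts:
  assumes "finite I" "(\<Sum>i\<in>I. star (y i) * y i) = scal c" "i \<in> I"
  shows "y i \<in> bounded_elts"
proof -
  have "nrm (y i * w) \<le> sqrt c * nrm w" for w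
  proof -
    have e: "star (y j * w) * (y j * w) = star w * (star (y j) * y j) * w" for j
      by (simp add: star_mult mult.assoc)
    have "(\<Sum>j\<in>I. \<mu> (star (y j * w) * (y j * w))) = \<mu> (star w * (\<Sum>j\<in>I. star (y j) * y j) * w)"
      unfolding e by (simp add: mu_sum sum_distrib_left sum_distrib_right)
    also have "\<dots> = c * \<mu> (star w * w)"
      by (simp add: assms(2) mult_scaleC_left mult_scaleC_right mu_scale)
    finally have "(\<Sum>j\<in>I. (nrm (y j * w))\<^sup>2) = c * (nrm w)\<^sup>2"
      unfolding nrm_sq by (simp flip: Re_sum)
    moreover have "(nrm (y i * w))\<^sup>2 \<le> (\<Sum>j\<in>I. (nrm (y j * w))\<^sup>2)"
      using assms(1,3) by (intro member_le_sum) auto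
    ultimately have "sqrt ((nrm (y i * w))\<^sup>2) \<le> sqrt (c * (nrm w)\<^sup>2)"
      by (simp only: real_sqrt_le_iff)
    then show ?thesis by (simp add: real_sqrt_mult nrm_nonneg)
  qed
  then show ?thesis by (auto simp: bounded_elts_def)
qed

definition opnorm :: "'z \<Rightarrow> real" where
  "opnorm z = (SUP w\<in>{w. nrm w \<le> 1}. nrm (z * w))"

lemma opnorm_le:
  assumes "\<And>w. nrm (z * w) \<le> K * nrm w" "K \<ge> 0"
  shows "opnorm z \<le> K"
  unfolding opnorm_def
proof (rule cSUP_least)
  show "{w. nrm w \<le> 1} \<noteq> {}" by (auto intro!: exI[of _ 0] simp: nrm_def lin clin_0)
  show "nrm (z * w) \<le> K" if "w \<in> {w. nrm w \<le> 1}" for w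
    using assms(1)[of w] mult_left_mono[of "nrm w" 1 K] that assms(2) by simp
qed

lemma opnorm_bound:
  assumes "z \<in> bounded_elts"
  shows "nrm (z * w) \<le> opnorm z * nrm w" and "opnorm z \<ge> 0"
proof -
  obtain K where K: "\<And>w. nrm (z * w) \<le> K * nrm w" using assms by (auto simp: bounded_elts_def)
  have bdd: "bdd_above ((\<lambda>w. nrm (z * w)) ` {w. nrm w \<le> 1})"
  proof (rule bdd_aboveI2)
    fix w assume "w \<in> {w. nrm w \<le> 1}"
    then have "\<bar>K\<bar> * nrm w \<le> \<bar>K\<bar> * 1" by (intro mult_left_mono) auto
    moreover have "K * nrm w \<le> \<bar>K\<bar> * nrm w" by (intro mult_right_mono nrm_nonneg) auto
    ultimately show "nrm (z * w) \<le> \<bar>K\<bar>" using K[of w] by linarith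
  qed
  have unit: "nrm (z * w) \<le> opnorm z" if "nrm w \<le> 1" for w
    unfolding opnorm_def using that by (intro cSUP_upper bdd) auto
  have "nrm (z * 0) \<le> opnorm z" by (rule unit) (simp add: nrm_def lin clin_0)
  then show "opnorm z \<ge> 0" using nrm_nonneg order_trans by blast
  show "nrm (z * w) \<le> opnorm z * nrm w"
  proof (cases "nrm w = 0")
    \<comment> \<open>A null vector cannot be normalised, but the constant K shows that z maps it to
      a null vector.\<close>
    case True
    then show ?thesis using K[of w] nrm_nonneg[of "z * w"] by simp
  next
    case False
    then have w: "nrm w > 0" using nrm_nonneg[of w] by simp
    have "nrm (z * (complex_of_real (1 / nrm w) *\<^sub>C w)) \<le> opnorm z"
      using w by (intro unit) (simp add: nrm_scale norm_divide)
    then show ?thesis using w by (simp add: mult_scaleC_right nrm_scale norm_divide field_simps)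
  qed
qed

lemma opnorm_cstar_seminorm:
  assumes "bounded_elts = UNIV"
  shows "cstar_seminorm opnorm"
proof -
  note b = opnorm_bound[unfolded assms, OF UNIV_I]
  have add: "opnorm (x + y) \<le> opnorm x + opnorm y" for x y
  proof (rule opnorm_le)
    fix w
    show "nrm ((x + y) * w) \<le> (opnorm x + opnorm y) * nrm w"
      using nrm_triangle[of "x * w" "y * w"] b(1)[of x w] b(1)[of y w] by (simp add: distrib_right)
  qed (simp add: b)
  have scale_le: "opnorm (c *\<^sub>C x) \<le> cmod c * opnorm x" for c x
  proof (rule opnorm_le)
    fix w
    show "nrm (c *\<^sub>C x * w) \<le> cmod c * opnorm x * nrm w"
      using mult_left_mono[OF b(1)[of x w], of "cmod c"] by (simp add: mult_scaleC_left nrm_scale mult.assoc)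
  qed (simp add: b)
  have scale: "opnorm (c *\<^sub>C x) = cmod c * opnorm x" for c x
  proof (cases "c = 0")
    case True
    then show ?thesis using scale_le[of c x] b(2)[of "c *\<^sub>C x"] by simp
  next
    case False
    then have "opnorm x \<le> cmod (inverse c) * opnorm (c *\<^sub>C x)"
      using scale_le[of "inverse c" "c *\<^sub>C x"] by (simp add: scaleC_scaleC scaleC_one)
    then have "cmod c * opnorm x \<le> opnorm (c *\<^sub>C x)"
      using False by (simp add: norm_divide inverse_eq_divide field_simps)
    with scale_le[of c x] show ?thesis by simp
  qed
  have mult: "opnorm (x * y) \<le> opnorm x * opnorm y" for x y
  proof (rule opnorm_le)
    fix w
    show "nrm (x * y * w) \<le> opnorm x * opnorm y * nrm w"
      using b(1)[of x "y * w"] mult_left_mono[OF b(1)[of y w] b(2)[of x]] by (simp add: mult.assoc)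
  qed (simp add: b)
  have sq: "(opnorm x)\<^sup>2 \<le> opnorm (star x * x)" for x
  proof -
    have "opnorm x \<le> sqrt (opnorm (star x * x))"
    proof (rule opnorm_le)
      fix w
      have "(nrm (x * w))\<^sup>2 = Re (\<mu> (star w * (star x * x * w)))"
        by (simp add: nrm_sq star_mult mult.assoc)
      also have "\<dots> \<le> nrm w * nrm (star x * x * w)"
        using Cauchy_Schwarz complex_Re_le_cmod order_trans by blast
      also have "\<dots> \<le> nrm w * (opnorm (star x * x) * nrm w)"
        by (intro mult_left_mono b nrm_nonneg)
      also have "\<dots> = (sqrt (opnorm (star x * x)) * nrm w)\<^sup>2"
        by (simp add: power_mult_distrib b) (simp add: power2_eq_square)
      finally show "nrm (x * w) \<le> sqrt (opnorm (star x * x)) * nrm w"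
        by (rule power2_le_imp_le) (simp add: b nrm_nonneg)
    qed (simp add: b)
    then have "(opnorm x)\<^sup>2 \<le> (sqrt (opnorm (star x * x)))\<^sup>2" by (intro power_mono b)
    then show ?thesis by (simp add: b)
  qed
  have st: "opnorm x \<le> opnorm (star x)" for x
  proof (cases "opnorm x = 0")
    case False
    have "opnorm x * opnorm x \<le> opnorm (star x) * opnorm x"
      using sq[of x] mult[of "star x" x] unfolding power2_eq_square by (rule order_trans)
    then show ?thesis using False b(2)[of x] by simp
  qed (simp add: b)
  have "opnorm (star x * x) = (opnorm x)\<^sup>2" for x
  proof (rule antisym[OF _ sq])
    have "opnorm (star x) \<le> opnorm x" using st[of "star x"] by (simp add: star_star)
    then have "opnorm (star x) * opnorm x \<le> opnorm x * opnorm x" by (intro mult_right_mono b)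
    then show "opnorm (star x * x) \<le> (opnorm x)\<^sup>2"
      using mult[of "star x" x] by (simp add: power2_eq_square)
  qed
  with add scale mult show ?thesis by (simp add: cstar_seminorm_def)
qed

end

section \<open>Galois extensions\<close>

lemma sum_list_upt: "(\<Sum>i\<leftarrow>[0..<n]. f i) = (\<Sum>i<n. (f i :: 'b::comm_monoid_add))"
  by (simp add: interv_sum_list_conv_sum_set_nat atLeast0LessThan)

text \<open>F itself is linear only up to \<open>teq\<close>; following it by a bilinear map into a
  vector space removes the ambiguity of representatives.\<close>

lemma clin_tensor_star_hom:
  assumes "tensor_star_hom F" "cbilin B"
  shows "clin (\<lambda>x. \<Sum>(a, b)\<leftarrow>F x. B a b)"
proof (rule clinI)
  have B: "clin (\<lambda>v. B v w)" for w using assms(2) by (auto simp: cbilin_def)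
  fix x y c
  have "teq (F (x + y)) (F x @ F y)" "teq (F (c *\<^sub>C x)) (map (\<lambda>(a, b). (c *\<^sub>C a, b)) (F x))"
    using assms(1) by (auto simp: tensor_star_hom_def)
  from this[THEN teq_cbilin, OF assms(2)]
  show "(\<Sum>(a, b)\<leftarrow>F (x + y). B a b) = (\<Sum>(a, b)\<leftarrow>F x. B a b) + (\<Sum>(a, b)\<leftarrow>F y. B a b)"
    "(\<Sum>(a, b)\<leftarrow>F (c *\<^sub>C x). B a b) = c *\<^sub>C (\<Sum>(a, b)\<leftarrow>F x. B a b)"
    by (simp_all add: o_def case_prod_unfold clin_scale[OF B] clin_sum_list[OF clin_smul[OF clin_id]])
qed

lemma tensor_star_hom_mult:
  assumes "tensor_star_hom F" "cbilin B"
  shows "(\<Sum>(a, b)\<leftarrow>F (x * y). B a b) = (\<Sum>(a, b)\<leftarrow>F x. \<Sum>(a', b')\<leftarrow>F y. B (a * a') (b * b'))"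
proof -
  have "teq (F (x * y)) (tmul (F x) (F y))" using assms(1) by (auto simp: tensor_star_hom_def)
  from teq_cbilin[OF this assms(2)] show ?thesis
    by (simp add: tmul_def sum_list_concat_map o_def case_prod_unfold)
qed

lemma cbilin_product: "clin f \<Longrightarrow> clin g \<Longrightarrow> cbilin (\<lambda>x y. f x * (g y :: complex))"
  by (intro cbilinI clin_cmult_left clin_cmult_right)

lemma cbilin_scale: "clin f \<Longrightarrow> cbilin (\<lambda>x y. f x *\<^sub>C y)" for f :: "_ \<Rightarrow> complex"
  by (intro cbilinI clin_smul_left clin_smul clin_id)

lemma cbilin_scale': "clin f \<Longrightarrow> cbilin (\<lambda>x y. f y *\<^sub>C x)" for f :: "_ \<Rightarrow> complex"
  by (intro cbilinI clin_smul_left clin_smul clin_id)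

lemma cbilin_comp:
  assumes "cbilin B" "clin f" "clin g"
  shows "cbilin (\<lambda>x y. B (f x) (g y))"
proof (rule cbilinI)
  fix v w
  have "clin (B (f v))" "clin (\<lambda>u. B u (g w))" using assms(1) by (simp_all add: cbilin_def)
  then show "clin (\<lambda>y. B (f v) (g y))" "clin (\<lambda>x. B (f x) (g w))"
    using clin_comp assms(2,3) by blast+
qed

lemma cbilin_sum:
  assumes "\<And>l. cbilin (B l)"
  shows "cbilin (\<lambda>x y. \<Sum>l\<in>I. B l x y)"
  by (intro cbilinI clin_sums) (use assms in \<open>simp_all add: cbilin_def\<close>)

locale hopf_galois =
  fixes \<Delta> :: "'a::star_alg \<Rightarrow> ('a \<times> 'a) list" and \<epsilon> :: "'a \<Rightarrow> complex" and S :: "'a \<Rightarrow> 'a"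
    and \<alpha> :: "'z::star_alg \<Rightarrow> ('a \<times> 'z) list" and \<mu> :: "'z \<Rightarrow> complex"
  assumes hopf: "hopf_star_algebra \<Delta> \<epsilon> S"
    and unit: "unitarizable \<Delta> \<epsilon>"
    and gal: "star_galois_extension \<Delta> \<epsilon> \<alpha>"
    and haar: "haar_measure \<alpha> \<mu>" and mu_pos: "positive_functional \<mu>"
begin

lemma Delta_hom: "tensor_star_hom \<Delta>" and alpha_hom: "tensor_star_hom \<alpha>"
  and clin_eps: "clin \<epsilon>" and clin_mu: "clin \<mu>" and mu_1: "\<mu> 1 = 1" and clin_S: "clin S"
  using hopf gal haar
  by (auto simp: hopf_star_algebra_def star_galois_extension_def haar_measure_def clinear_fun_clin clin_def)

sublocale positive_form \<mu>
  by standard (rule clin_mu, rule mu_pos)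

lemma alpha_counit: "(\<Sum>(a, y)\<leftarrow>\<alpha> z. \<epsilon> a *\<^sub>C y) = z"
  using gal by (auto simp: star_galois_extension_def left_coaction_def)

lemma antipode: "(\<Sum>(u, v)\<leftarrow>\<Delta> x. S u * v) = \<epsilon> x *\<^sub>C 1"
  using hopf by (auto simp: hopf_star_algebra_def)

lemma mu_invariant: "(\<Sum>(a, y)\<leftarrow>\<alpha> z. \<mu> y *\<^sub>C a) = \<mu> z *\<^sub>C 1"
  using haar by (auto simp: haar_measure_def)

lemma alpha_coassoc:
  assumes "ctrilin B"
  shows "(\<Sum>(a, y)\<leftarrow>\<alpha> z. \<Sum>(p, q)\<leftarrow>\<Delta> a. B p q y) = (\<Sum>(a, y)\<leftarrow>\<alpha> z. \<Sum>(b, x)\<leftarrow>\<alpha> y. B a b x)"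
proof -
  have "teq3 (concat [map (\<lambda>(p, q). (p, q, y)) (\<Delta> a). (a, y) \<leftarrow> \<alpha> z])
                (concat [map (\<lambda>(b, x). (a, b, x)) (\<alpha> y). (a, y) \<leftarrow> \<alpha> z])"
    using gal by (auto simp: star_galois_extension_def left_coaction_def)
  from teq3_ctrilin[OF this assms] show ?thesis
    by (simp add: sum_list_concat_map case_prod_unfold o_def)
qed

text \<open>The subcomodule generated by \<open>z\<close> is the space of all slices \<open>(g \<otimes> id) (\<alpha> z)\<close>.\<close>

lemma subcomodule_basis:
  obtains n and e :: "nat \<Rightarrow> 'z" and a :: "nat \<Rightarrow> nat \<Rightarrow> 'a" where
    "z \<in> cvs.span (e ` {..<n})"
    "\<And>i. i < n \<Longrightarrow> teq (\<alpha> (e i)) (map (\<lambda>j. (a i j, e j)) [0..<n])"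
    "\<And>i j. i < n \<Longrightarrow> j < n \<Longrightarrow> teq (\<Delta> (a i j)) (map (\<lambda>k. (a i k, a k j)) [0..<n])"
    "\<And>i j. i < n \<Longrightarrow> j < n \<Longrightarrow> \<epsilon> (a i j) = (if i = j then 1 else 0)"
proof -
  define sl where "sl g v = (\<Sum>(b, y)\<leftarrow>\<alpha> v. g b *\<^sub>C y)" for g :: "'a \<Rightarrow> complex" and v
  have clin_sl: "clin (sl g)" if "clin g" for g
    unfolding sl_def by (intro clin_tensor_star_hom alpha_hom cbilin_scale that)
  define V where "V = {sl g z |g. clin g}"
  have subV: "cvs.subspace V"
  proof (rule cvs.subspaceI)
    have "sl (\<lambda>_. 0) z = 0" by (simp add: sl_def case_prod_unfold)
    then show "0 \<in> V" unfolding V_def using clin_zero by (metis (mono_tags, lifting) mem_Collect_eq)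
  next
    fix x y assume "x \<in> V" "y \<in> V"
    then obtain g h where gh: "clin g" "clin h" "x = sl g z" "y = sl h z" by (auto simp: V_def)
    have "x + y = sl (\<lambda>b. g b + h b) z"
      by (simp add: gh sl_def case_prod_unfold scaleC_add_left sum_list_addf)
    then show "x + y \<in> V" unfolding V_def using clin_plus[OF gh(1,2)] by blast
  next
    fix c x assume "x \<in> V"
    then obtain g where g: "clin g" "x = sl g z" by (auto simp: V_def)
    have "c *\<^sub>C x = sl (\<lambda>b. c *\<^sub>C g b) z"
      by (simp add: g sl_def case_prod_unfold clin_sum_list[OF clin_smul[OF clin_id]] scaleC_scaleC scaleC_complex_def)
    then show "c *\<^sub>C x \<in> V" unfolding V_def using clin_smul[OF g(1)] by blast
  qed
  have zV: "z \<in> V" unfolding V_def using clin_eps alpha_counit[of z] by (auto simp: sl_def intro!: exI[of _ \<epsilon>])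
  have slV: "sl g' v \<in> V" if g': "clin g'" and v: "v \<in> V" for g' v
  proof -
    obtain g where g: "clin g" "v = sl g z" using v by (auto simp: V_def)
    \<comment> \<open>The convolution product of g and g'. By coassociativity two successive slices
      are one slice along h, so the slices of z form a subcomodule.\<close>
    define h where "h c = (\<Sum>(p, q)\<leftarrow>\<Delta> c. g p * g' q)" for c
    have h: "clin h" unfolding h_def by (intro clin_tensor_star_hom Delta_hom cbilin_product g g')
    have tri: "ctrilin (\<lambda>p q y. (g p * g' q) *\<^sub>C (y::'z))"
      by (intro ctrilinI clin_smul clin_id clin_smul_left clin_cmult_left clin_cmult_right g g')
    have "sl g' v = (\<Sum>(b, y)\<leftarrow>\<alpha> z. g b *\<^sub>C sl g' y)"
      unfolding g(2) sl_def[of g] by (simp add: clin_sum_list[OF clin_sl[OF g']] case_prod_unfold clin_scale[OF clin_sl[OF g']])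
    also have "\<dots> = (\<Sum>(b, y)\<leftarrow>\<alpha> z. \<Sum>(b', x)\<leftarrow>\<alpha> y. (g b * g' b') *\<^sub>C x)"
      by (simp add: sl_def case_prod_unfold clin_sum_list[OF clin_smul[OF clin_id]] scaleC_scaleC)
    also have "\<dots> = (\<Sum>(c, y)\<leftarrow>\<alpha> z. \<Sum>(p, q)\<leftarrow>\<Delta> c. (g p * g' q) *\<^sub>C y)"
      by (rule alpha_coassoc[OF tri, symmetric])
    also have "\<dots> = sl h z"
      by (simp add: sl_def h_def case_prod_unfold clin_sum_list[OF clin_smul_left[OF clin_id]])
    finally show ?thesis unfolding V_def using h by blast
  qed
  obtain B where B: "B \<subseteq> V" "cvs.independent B" "V \<subseteq> cvs.span B"
    using cvs.basis_exists[of V] by metis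
  \<comment> \<open>Every slice combines the finitely many second legs of the list
    \<open>\<alpha> z\<close>; this is why the subcomodule has finite dimension.\<close>
  have "v \<in> cvs.span (snd ` set (\<alpha> z))" if "v \<in> V" for v
  proof -
    have "(\<Sum>(b, y)\<leftarrow>xs. g b *\<^sub>C y) \<in> cvs.span (snd ` set (\<alpha> z))" if "set xs \<subseteq> set (\<alpha> z)" for xs and g :: "'a \<Rightarrow> complex"
      using that
    proof (induction xs)
      case (Cons x xs)
      then show ?case
        by (cases x) (force intro!: cvs.span_add cvs.span_scale intro: cvs.span_base)
    qed (simp add: cvs.span_zero)
    then show ?thesis using \<open>v \<in> V\<close> by (auto simp: V_def sl_def)
  qed
  then have "B \<subseteq> cvs.span (snd ` set (\<alpha> z))" using B by blast
  then have finB: "finite B" using cvs.independent_span_bound[OF _ B(2)] by blast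
  then obtain n and e :: "nat \<Rightarrow> 'z" where e: "B = e ` {..<n}" "inj_on e {..<n}"
    using finite_imp_nat_seg_image_inj_on[OF finB] by (auto simp: lessThan_def)
  obtain f where f: "\<And>b. clin (f b :: 'z \<Rightarrow> complex)"
    "\<And>b c. b \<in> B \<Longrightarrow> c \<in> B \<Longrightarrow> f b c = (if b = c then 1 else 0)"
    "\<And>v. v \<in> cvs.span B \<Longrightarrow> finite {b. f b v \<noteq> 0} \<and> {b. f b v \<noteq> 0} \<subseteq> B
        \<and> v = (\<Sum>b | f b v \<noteq> 0. f b v *\<^sub>C b)"
    by (rule coordinate_functionals[OF B(2)]) blast
  define fe where "fe j = f (e j)" for j
  have fe: "clin (fe j)" for j using f(1) by (simp add: fe_def)
  have eV: "e i \<in> V" if "i < n" for i using B(1) e(1) that by auto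
  have expand: "v = (\<Sum>j<n. fe j v *\<^sub>C e j)" if "v \<in> V" for v
  proof -
    have v: "v \<in> cvs.span B" using that B(3) by auto
    have "v = (\<Sum>b | f b v \<noteq> 0. f b v *\<^sub>C b)" using f(3)[OF v] by blast
    also have "\<dots> = (\<Sum>b\<in>B. f b v *\<^sub>C b)"
      using f(3)[OF v] finB by (intro sum.mono_neutral_left) auto
    also have "\<dots> = (\<Sum>j<n. fe j v *\<^sub>C e j)"
      unfolding e(1) fe_def using e(2) by (simp add: sum.reindex)
    finally show ?thesis .
  qed
  define a where "a i j = (\<Sum>(b, y)\<leftarrow>\<alpha> (e i). fe j y *\<^sub>C b)" for i j
  have fa: "g (a i j) = (\<Sum>(b, y)\<leftarrow>\<alpha> (e i). g b * fe j y)" if "clin g" for g :: "'a \<Rightarrow> complex" and i j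
    by (simp add: a_def clin_sum_list[OF that] case_prod_unfold clin_scale[OF that] scaleC_complex_def mult.commute)
  have t1: "teq (\<alpha> (e i)) (map (\<lambda>j. (a i j, e j)) [0..<n])" if i: "i < n" for i
    unfolding teq_clin
  proof (intro allI impI)
    fix g :: "'a \<Rightarrow> complex" and h :: "'z \<Rightarrow> complex" assume g: "clin g" and h: "clin h"
    define u where "u = sl g (e i)"
    have "(\<Sum>(v, w)\<leftarrow>\<alpha> (e i). g v * h w) = h u"
      by (simp add: u_def sl_def clin_sum_list[OF h] case_prod_unfold clin_scale[OF h] scaleC_complex_def)
    also have "\<dots> = (\<Sum>j<n. fe j u * h (e j))"
      by (subst expand[OF slV[OF g eV[OF i], folded u_def]])
        (simp add: clin_sum[OF h] clin_scale[OF h] scaleC_complex_def)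
    also have "\<dots> = (\<Sum>j<n. g (a i j) * h (e j))"
      by (simp add: fa[OF g] u_def sl_def clin_sum_list[OF fe] case_prod_unfold clin_scale[OF fe] scaleC_complex_def)
    finally show "(\<Sum>(v, w)\<leftarrow>\<alpha> (e i). g v * h w) = (\<Sum>(v, w)\<leftarrow>map (\<lambda>j. (a i j, e j)) [0..<n]. g v * h w)"
      by (simp add: o_def sum_list_upt)
  qed
  have t2: "teq (\<Delta> (a i j)) (map (\<lambda>k. (a i k, a k j)) [0..<n])" if ij: "i < n" "j < n" for i j
    unfolding teq_clin
  proof (intro allI impI)
    fix g h :: "'a \<Rightarrow> complex" assume g: "clin g" and h: "clin h"
    define L where "L x = (\<Sum>(p, q)\<leftarrow>\<Delta> x. g p * h q)" for x
    have L: "clin L" unfolding L_def by (intro clin_tensor_star_hom Delta_hom cbilin_product g h)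
    define M where "M x = (\<Sum>(b, y)\<leftarrow>\<alpha> x. h b * fe j y)" for x
    have M: "clin M" unfolding M_def by (intro clin_tensor_star_hom alpha_hom cbilin_product h fe)
    have tri: "ctrilin (\<lambda>p q y. g p * h q * fe j y)"
      by (intro ctrilinI clin_cmult_left clin_cmult_right g h fe)
    have "L (a i j) = (\<Sum>(b, y)\<leftarrow>\<alpha> (e i). \<Sum>(p, q)\<leftarrow>\<Delta> b. g p * h q * fe j y)"
      by (simp add: fa[OF L]) (simp add: L_def case_prod_unfold sum_list_mult_const)
    also have "\<dots> = (\<Sum>(b, y)\<leftarrow>\<alpha> (e i). \<Sum>(b', x)\<leftarrow>\<alpha> y. g b * h b' * fe j x)"
      by (rule alpha_coassoc[OF tri])
    also have "\<dots> = (\<Sum>(b, y)\<leftarrow>\<alpha> (e i). g b * M y)"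
      by (simp add: M_def case_prod_unfold sum_list_const_mult mult.assoc)
    also have "\<dots> = (\<Sum>(b, y)\<leftarrow>map (\<lambda>j. (a i j, e j)) [0..<n]. g b * M y)"
      by (intro teq_cbilin t1 ij cbilin_product g M)
    also have "\<dots> = (\<Sum>k<n. g (a i k) * h (a k j))"
      by (simp add: o_def sum_list_upt fa[OF h] M_def)
    finally show "(\<Sum>(v, w)\<leftarrow>\<Delta> (a i j). g v * h w) = (\<Sum>(v, w)\<leftarrow>map (\<lambda>k. (a i k, a k j)) [0..<n]. g v * h w)"
      by (simp add: o_def sum_list_upt L_def)
  qed
  have t3: "\<epsilon> (a i j) = (if i = j then 1 else 0)" if ij: "i < n" "j < n" for i j
  proof -
    have "\<epsilon> (a i j) = fe j (\<Sum>(b, y)\<leftarrow>\<alpha> (e i). \<epsilon> b *\<^sub>C y)"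
      by (simp add: fa[OF clin_eps] clin_sum_list[OF fe] case_prod_unfold clin_scale[OF fe] scaleC_complex_def)
    also have "\<dots> = fe j (e i)" by (simp add: alpha_counit)
    also have "\<dots> = (if i = j then 1 else 0)"
      using f(2)[of "e j" "e i"] e ij by (auto simp: fe_def inj_on_def)
    finally show ?thesis .
  qed
  have "z \<in> cvs.span (e ` {..<n})" using zV B(3) e(1) by auto
  with t1 t2 t3 show ?thesis by (intro that)
qed

text \<open>Unitarizability speaks of right comodules while the matrix comes from a left coaction.
  The same matrix, without the antipode, defines a right comodule on the dual space, sending
  \<open>u k\<close> to the sum of the tensors of \<open>u i\<close> and
  \<open>a i k\<close>.\<close>

lemma matrix_invariant_form:
  assumes D: "\<And>i j. i < n \<Longrightarrow> j < n \<Longrightarrow> teq (\<Delta> (a i j)) (map (\<lambda>k. (a i k, a k j)) [0..<n])"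
    and E: "\<And>i j. i < n \<Longrightarrow> j < n \<Longrightarrow> \<epsilon> (a i j) = (if i = j then 1 else 0)"
  obtains F where "\<And>i j. i < n \<Longrightarrow> j < n \<Longrightarrow> F j i = cnj (F i j)"
    "\<And>x i. i < n \<Longrightarrow> x i \<noteq> 0 \<Longrightarrow> Re (\<Sum>i<n. \<Sum>j<n. F i j * (cnj (x i) * x j)) > 0"
    "\<And>k l. k < n \<Longrightarrow> l < n \<Longrightarrow> (\<Sum>i<n. \<Sum>j<n. F i j *\<^sub>C (star (a i k) * a j l)) = F k l *\<^sub>C 1"
proof -
  define u :: "nat \<Rightarrow> nat \<Rightarrow> complex" where "u i = (\<lambda>j. if j = i then 1 else 0)" for i
  define m where "m v i = (\<Sum>k<n. v k *\<^sub>C a i k)" for v :: "nat \<Rightarrow> complex" and i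
  define \<beta> where "\<beta> v = map (\<lambda>i. (u i, m v i)) [0..<n]" for v
  have u: "u i \<in> cspace n" if "i < n" for i using that by (auto simp: u_def cspace_def)
  have mu: "m (u k) i = a i k" if "k < n" for k i
  proof -
    have "m (u k) i = (\<Sum>k'<n. if k' = k then a i k' else 0)"
      unfolding m_def u_def by (intro sum.cong) (auto simp: scaleC_one)
    then show ?thesis using that by (simp add: sum.delta)
  qed
  have m_add: "m (v + w) i = m v i + m w i" for v w i
    by (simp add: m_def scaleC_add_left sum.distrib)
  have m_scale: "m (c *\<^sub>C v) i = c *\<^sub>C m v i" for c v i
    by (simp add: m_def scaleC_fun_def scaleC_complex_def cvs.scale_sum_right scaleC_scaleC)
  have "right_comodule \<Delta> \<epsilon> n \<beta>"
    unfolding right_comodule_def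
  proof (intro conjI ballI allI)
    fix v show "fst ` set (\<beta> v) \<subseteq> cspace n" using u by (auto simp: \<beta>_def)
  next
    fix v w show "teq (\<beta> (v + w)) (\<beta> v @ \<beta> w)"
      unfolding teq_clin by (simp add: \<beta>_def o_def sum_list_upt m_add clin_add distrib_left sum.distrib)
  next
    fix c v show "teq (\<beta> (c *\<^sub>C v)) (map (\<lambda>(u, a). (c *\<^sub>C u, a)) (\<beta> v))"
      unfolding teq_clin
      by (simp add: \<beta>_def o_def sum_list_upt m_scale clin_scale scaleC_complex_def mult_ac)
  next
    fix v
    show "teq3 (concat [map (\<lambda>(w, b). (w, b, a)) (\<beta> u). (u, a) \<leftarrow> \<beta> v])
               (concat [map (\<lambda>(p, q). (u, p, q)) (\<Delta> a). (u, a) \<leftarrow> \<beta> v])"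
      unfolding teq3_def clinear_fun_clin
    proof (intro allI impI)
      fix f :: "(nat \<Rightarrow> complex) \<Rightarrow> complex" and g h :: "'a \<Rightarrow> complex"
      assume f: "clin f" and g: "clin g" and h: "clin h"
      define L where "L x = (\<Sum>(p, q)\<leftarrow>\<Delta> x. g p * h q)" for x
      have L: "clin L" unfolding L_def by (intro clin_tensor_star_hom Delta_hom cbilin_product g h)
      have La: "L (a i k) = (\<Sum>j<n. g (a i j) * h (a j k))" if "i < n" "k < n" for i k
        using teq_cbilin[OF D[OF that] cbilin_product[OF g h]] by (simp add: L_def o_def sum_list_upt)
      have Lm: "L (m v i) = (\<Sum>j<n. g (a i j) * h (m v j))" if "i < n" for i
      proof -
        have "L (m v i) = (\<Sum>k<n. v k * (\<Sum>j<n. g (a i j) * h (a j k)))"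
          by (simp add: m_def clin_sum[OF L] clin_scale[OF L] scaleC_complex_def La that)
        also have "\<dots> = (\<Sum>j<n. \<Sum>k<n. v k * (g (a i j) * h (a j k)))"
          unfolding sum_distrib_left by (rule sum.swap)
        also have "\<dots> = (\<Sum>j<n. g (a i j) * h (m v j))"
          by (simp add: m_def clin_sum[OF h] clin_scale[OF h] scaleC_complex_def sum_distrib_left mult_ac)
        finally show ?thesis .
      qed
      have "(\<Sum>(w, b, a)\<leftarrow>concat [map (\<lambda>(w, b). (w, b, a)) (\<beta> u). (u, a) \<leftarrow> \<beta> v]. f w * g b * h a)
        = (\<Sum>i<n. \<Sum>j<n. f (u j) * g (a j i) * h (m v i))"
        by (simp add: \<beta>_def sum_list_concat_map o_def case_prod_unfold sum_list_upt mu)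
      also have "\<dots> = (\<Sum>j<n. \<Sum>i<n. f (u j) * g (a j i) * h (m v i))" by (rule sum.swap)
      also have "\<dots> = (\<Sum>j<n. f (u j) * L (m v j))"
        by (simp add: Lm sum_distrib_left mult.assoc)
      also have "\<dots> = (\<Sum>(u, p, q)\<leftarrow>concat [map (\<lambda>(p, q). (u, p, q)) (\<Delta> a). (u, a) \<leftarrow> \<beta> v]. f u * g p * h q)"
        by (simp add: \<beta>_def L_def sum_list_concat_map o_def case_prod_unfold sum_list_upt
            sum_list_const_mult mult.assoc)
      finally show "(\<Sum>(w, b, a)\<leftarrow>concat [map (\<lambda>(w, b). (w, b, a)) (\<beta> u). (u, a) \<leftarrow> \<beta> v]. f w * g b * h a) =
         (\<Sum>(u, p, q)\<leftarrow>concat [map (\<lambda>(p, q). (u, p, q)) (\<Delta> a). (u, a) \<leftarrow> \<beta> v]. f u * g p * h q)" .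
    qed
  next
    fix v assume v: "v \<in> cspace n"
    have "\<epsilon> (m v i) = v i" if "i < n" for i
    proof -
      have "\<epsilon> (m v i) = (\<Sum>k<n. if k = i then v k else 0)"
        unfolding m_def clin_sum[OF clin_eps]
        by (intro sum.cong) (auto simp: clin_scale[OF clin_eps] E that scaleC_complex_def)
      then show ?thesis using that by (simp add: sum.delta)
    qed
    then have "(\<Sum>(w, b)\<leftarrow>\<beta> v. \<epsilon> b *\<^sub>C w) = (\<Sum>i<n. v i *\<^sub>C u i)"
      by (simp add: \<beta>_def o_def sum_list_upt)
    also have "\<dots> = v"
    proof
      fix j
      have app: "(\<Sum>i\<in>I. f i) j = (\<Sum>i\<in>I. f i j)" for I and f :: "nat \<Rightarrow> nat \<Rightarrow> complex"
        by (induction I rule: infinite_finite_induct) auto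
      have "(\<Sum>i<n. v i *\<^sub>C u i) j = (\<Sum>i<n. if j = i then v i else 0)"
        unfolding app by (intro sum.cong) (auto simp: scaleC_fun_def scaleC_complex_def u_def)
      then show "(\<Sum>i<n. v i *\<^sub>C u i) j = v j" using v by (auto simp: cspace_def sum.delta')
    qed
    finally show "(\<Sum>(w, b)\<leftarrow>\<beta> v. \<epsilon> b *\<^sub>C w) = v" .
  qed
  then obtain \<phi> where phi: "invariant_scalar_product n \<beta> \<phi>"
    using unit by (auto simp: unitarizable_def)
  define F where "F i j = \<phi> (u i) (u j)" for i j
  have herm: "\<phi> w v = cnj (\<phi> v w)" if "v \<in> cspace n" "w \<in> cspace n" for v w
    using phi that unfolding invariant_scalar_product_def by blast
  have phi_add: "\<phi> v (w + w') = \<phi> v w + \<phi> v w'" if "v \<in> cspace n" "w \<in> cspace n" "w' \<in> cspace n" for v w w'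
    using phi that unfolding invariant_scalar_product_def by blast
  have phi_scale: "\<phi> v (c *\<^sub>C w) = c * \<phi> v w" if "v \<in> cspace n" "w \<in> cspace n" for v w c
    using phi that unfolding invariant_scalar_product_def by blast
  have sub: "cvs.subspace (cspace n)"
    by (rule cvs.subspaceI) (auto simp: cspace_def scaleC_fun_def scaleC_complex_def)
  have lin_sum: "\<phi> v (\<Sum>j\<in>J. x j *\<^sub>C u j) = (\<Sum>j\<in>J. x j * \<phi> v (u j))"
    if v: "v \<in> cspace n" and J: "finite J" "J \<subseteq> {..<n}" for v x J
    using J
  proof (induction J rule: finite_induct)
    case empty
    have "\<phi> v (0 *\<^sub>C 0) = 0 * \<phi> v 0"
      by (intro phi_scale v cvs.subspace_0[OF sub])
    then have "\<phi> v 0 = 0" by (simp only: cvs.scale_zero_left mult_zero_left)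
    then show ?case by (simp only: sum.empty)
  next
    case (insert j J)
    have "x j *\<^sub>C u j \<in> cspace n" "(\<Sum>j\<in>J. x j *\<^sub>C u j) \<in> cspace n"
      using insert u by (auto intro!: cvs.subspace_scale[OF sub] cvs.subspace_sum[OF sub])
    then have "\<phi> v (x j *\<^sub>C u j + (\<Sum>j\<in>J. x j *\<^sub>C u j)) = x j * \<phi> v (u j) + \<phi> v (\<Sum>j\<in>J. x j *\<^sub>C u j)"
      using u insert.prems by (simp add: phi_add phi_scale v)
    moreover have "\<phi> v (\<Sum>j\<in>J. x j *\<^sub>C u j) = (\<Sum>j\<in>J. x j * \<phi> v (u j))"
      using insert by simp
    ultimately show ?case unfolding sum.insert[OF insert.hyps] by (simp only:)
  qed
  show ?thesis
  proof (rule that[of F])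
    fix i j assume "i < n" "j < n"
    then show "F j i = cnj (F i j)" unfolding F_def by (intro herm u)
  next
    fix x :: "nat \<Rightarrow> complex" and i assume i: "i < n" "x i \<noteq> 0"
    define X where "X = (\<Sum>j<n. x j *\<^sub>C u j)"
    have X: "X \<in> cspace n"
      unfolding X_def using u by (auto intro!: cvs.subspace_scale[OF sub] cvs.subspace_sum[OF sub])
    have app: "(\<Sum>i\<in>I. f i) j = (\<Sum>i\<in>I. f i j)" for I j and f :: "nat \<Rightarrow> nat \<Rightarrow> complex"
      by (induction I rule: infinite_finite_induct) auto
    have "X i = (\<Sum>j<n. if j = i then x j else 0)"
      unfolding X_def app by (intro sum.cong) (auto simp: scaleC_fun_def scaleC_complex_def u_def)
    then have "X i \<noteq> 0" using i by simp
    then have "X \<noteq> 0" by auto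
    then have "Re (\<phi> X X) > 0" using phi X unfolding invariant_scalar_product_def by blast
    also have "\<phi> X X = (\<Sum>j<n. x j * \<phi> X (u j))"
      using lin_sum[OF X, of "{..<n}" x] by (simp add: X_def)
    \<comment> \<open>The scalar product is linear by definition in the second variable only, so the
      first is expanded through hermitian symmetry.\<close>
    also have "\<dots> = (\<Sum>j<n. x j * cnj (\<Sum>i<n. x i * F j i))"
    proof (intro sum.cong refl)
      fix j assume "j \<in> {..<n}"
      then have "\<phi> X (u j) = cnj (\<phi> (u j) X)" using X by (intro herm u) auto
      also have "\<phi> (u j) X = (\<Sum>i<n. x i * F j i)"
        using lin_sum[OF u, of j "{..<n}" x] \<open>j \<in> {..<n}\<close> by (simp add: X_def F_def)
      finally show "x j * \<phi> X (u j) = x j * cnj (\<Sum>i<n. x i * F j i)" by simp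
    qed
    also have "\<dots> = (\<Sum>j<n. \<Sum>i<n. F i j * (cnj (x i) * x j))"
    proof -
      have "cnj (F j i) = F i j" if "i < n" "j < n" for i j
        unfolding F_def using herm[OF u u, of j i] that by simp
      then show ?thesis by (simp add: sum_distrib_left mult_ac)
    qed
    also have "\<dots> = (\<Sum>i<n. \<Sum>j<n. F i j * (cnj (x i) * x j))" by (rule sum.swap)
    finally show "0 < Re (\<Sum>i<n. \<Sum>j<n. F i j * (cnj (x i) * x j))" .
  next
    fix k l assume kl: "k < n" "l < n"
    have "(\<Sum>(v', a)\<leftarrow>\<beta> (u k). \<Sum>(w', b)\<leftarrow>\<beta> (u l). \<phi> v' w' *\<^sub>C (star a * b)) = \<phi> (u k) (u l) *\<^sub>C 1"
      using phi u[OF kl(1)] u[OF kl(2)] unfolding invariant_scalar_product_def by blast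
    then show "(\<Sum>i<n. \<Sum>j<n. F i j *\<^sub>C (star (a i k) * a j l)) = F k l *\<^sub>C 1"
      by (simp add: \<beta>_def o_def sum_list_upt mu kl F_def)
  qed
qed

text \<open>For coinvariant w the Galois map sends both \<open>w \<otimes> 1\<close> and
  \<open>1 \<otimes> w\<close> to \<open>1 \<otimes> w\<close>. Injectivity makes them equal, and
  applying \<open>\<mu>\<close> to the second leg gives the scalar.\<close>

lemma coinvariant_scalar:
  assumes "teq (\<alpha> w) [(1, w)]"
  shows "w = \<mu> w *\<^sub>C 1"
proof -
  have "teq (galois_map \<alpha> [(w, 1)]) [(1, w)]"
    using assms by (simp add: galois_map_def)
  moreover have "teq (galois_map \<alpha> [(1, w)]) [(1, w)]"
  proof (rule teqI)
    fix B :: "'a \<Rightarrow> 'z \<Rightarrow> complex" assume B: "cbilin B"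
    have "teq (\<alpha> 1) [(1, 1)]" using alpha_hom by (simp add: tensor_star_hom_def)
    from teq_cbilin[OF this cbilin_comp[OF B clin_id clin_mult_right[OF clin_id]]]
    show "(\<Sum>(a, y)\<leftarrow>galois_map \<alpha> [(1, w)]. B a y) = (\<Sum>(a, y)\<leftarrow>[(1, w)]. B a y)"
      by (simp add: galois_map_def o_def case_prod_unfold)
  qed
  ultimately have "teq [(w, 1)] [(1, w)]"
    using gal unfolding star_galois_extension_def by (meson teq_sym teq_trans)
  from teq_cbilin[OF this cbilin_scale'[OF clin_mu]] show ?thesis
    by (simp add: mu_1 scaleC_one)
qed

lemma invariant_sum_of_squares:
  obtains n c and y :: "nat \<Rightarrow> 'z" where "c \<ge> 0" "(\<Sum>k<n. star (y k) * y k) = scal c"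
    "z \<in> cvs.span (y ` {..<n})"
proof -
  obtain n and e :: "nat \<Rightarrow> 'z" and a :: "nat \<Rightarrow> nat \<Rightarrow> 'a" where
    z: "z \<in> cvs.span (e ` {..<n})"
    and A: "\<And>i. i < n \<Longrightarrow> teq (\<alpha> (e i)) (map (\<lambda>j. (a i j, e j)) [0..<n])"
    and D: "\<And>i j. i < n \<Longrightarrow> j < n \<Longrightarrow> teq (\<Delta> (a i j)) (map (\<lambda>k. (a i k, a k j)) [0..<n])"
    and E: "\<And>i j. i < n \<Longrightarrow> j < n \<Longrightarrow> \<epsilon> (a i j) = (if i = j then 1 else 0)"
    by (rule subcomodule_basis) blast
  obtain F where F: "\<And>i j. i < n \<Longrightarrow> j < n \<Longrightarrow> F j i = cnj (F i j)"
    "\<And>x i. i < n \<Longrightarrow> x i \<noteq> 0 \<Longrightarrow> Re (\<Sum>i<n. \<Sum>j<n. F i j * (cnj (x i) * x j)) > 0"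
    "\<And>k l. k < n \<Longrightarrow> l < n \<Longrightarrow> (\<Sum>i<n. \<Sum>j<n. F i j *\<^sub>C (star (a i k) * a j l)) = F k l *\<^sub>C 1"
    by (rule matrix_invariant_form[OF D E]) blast+
  define W where "W = (\<Sum>i<n. \<Sum>j<n. F i j *\<^sub>C (star (e i) * e j))"
  have "teq (\<alpha> W) [(1, W)]"
  proof (rule teqI)
    fix B :: "'a \<Rightarrow> 'z \<Rightarrow> complex" assume B: "cbilin B"
    then have Bl: "clin (B a)" "clin (\<lambda>a. B a y)" for a y by (auto simp: cbilin_def)
    define L where "L x = (\<Sum>(a, y)\<leftarrow>\<alpha> x. B a y)" for x
    have L: "clin L" unfolding L_def by (intro clin_tensor_star_hom alpha_hom B)
    have Le: "L (star (e i) * e j) = (\<Sum>k<n. \<Sum>l<n. B (star (a i k) * a j l) (star (e k) * e l))"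
      if ij: "i < n" "j < n" for i j
    proof -
      have "teq (\<alpha> (star (e i))) (map (\<lambda>(a, b). (star a, star b)) (\<alpha> (e i)))"
        using alpha_hom by (simp add: tensor_star_hom_def)
      from teq_trans[OF this teq_map_star[OF A[OF ij(1)]]]
      have st: "teq (\<alpha> (star (e i))) (map (\<lambda>k. (star (a i k), star (e k))) [0..<n])"
        by (simp add: o_def)
      have b2: "cbilin (\<lambda>b' y'. B (b * b') (y * y'))" for b y
        by (rule cbilin_comp[OF B clin_mult_left[OF clin_id] clin_mult_left[OF clin_id]])
      have b1: "cbilin (\<lambda>b y. \<Sum>l<n. B (b * a j l) (y * e l))"
        by (rule cbilin_sum, rule cbilin_comp[OF B clin_mult_right[OF clin_id] clin_mult_right[OF clin_id]])
      have "L (star (e i) * e j) = (\<Sum>(b, y)\<leftarrow>\<alpha> (star (e i)). \<Sum>(b', y')\<leftarrow>\<alpha> (e j). B (b * b') (y * y'))"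
        unfolding L_def by (rule tensor_star_hom_mult[OF alpha_hom B])
      also have "\<dots> = (\<Sum>(b, y)\<leftarrow>\<alpha> (star (e i)). \<Sum>l<n. B (b * a j l) (y * e l))"
        by (simp add: teq_cbilin[OF A[OF ij(2)] b2] o_def sum_list_upt)
      also have "\<dots> = (\<Sum>k<n. \<Sum>l<n. B (star (a i k) * a j l) (star (e k) * e l))"
        by (simp add: teq_cbilin[OF st b1] o_def sum_list_upt)
      finally show ?thesis .
    qed
    \<comment> \<open>The following exchanges bring the sums over i and j innermost, where
      invariance of F collapses the first leg to \<open>F k l\<close> times 1.\<close>
    have "L W = (\<Sum>i<n. \<Sum>j<n. \<Sum>k<n. \<Sum>l<n. F i j * B (star (a i k) * a j l) (star (e k) * e l))"
      by (simp add: W_def clin_sum[OF L] clin_scale[OF L] Le scaleC_complex_def sum_distrib_left)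
    also have "\<dots> = (\<Sum>i<n. \<Sum>k<n. \<Sum>l<n. \<Sum>j<n. F i j * B (star (a i k) * a j l) (star (e k) * e l))"
    proof (rule sum.cong[OF refl])
      fix i
      have "(\<Sum>j<n. \<Sum>k<n. \<Sum>l<n. F i j * B (star (a i k) * a j l) (star (e k) * e l)) =
         (\<Sum>k<n. \<Sum>j<n. \<Sum>l<n. F i j * B (star (a i k) * a j l) (star (e k) * e l))" by (rule sum.swap)
      also have "\<dots> = (\<Sum>k<n. \<Sum>l<n. \<Sum>j<n. F i j * B (star (a i k) * a j l) (star (e k) * e l))"
        by (intro sum.cong refl sum.swap)
      finally show "(\<Sum>j<n. \<Sum>k<n. \<Sum>l<n. F i j * B (star (a i k) * a j l) (star (e k) * e l)) = \<dots>" .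
    qed
    also have "\<dots> = (\<Sum>k<n. \<Sum>i<n. \<Sum>l<n. \<Sum>j<n. F i j * B (star (a i k) * a j l) (star (e k) * e l))"
      by (rule sum.swap)
    also have "\<dots> = (\<Sum>k<n. \<Sum>l<n. \<Sum>i<n. \<Sum>j<n. F i j * B (star (a i k) * a j l) (star (e k) * e l))"
      by (intro sum.cong refl sum.swap)
    also have "\<dots> = (\<Sum>k<n. \<Sum>l<n. B (\<Sum>i<n. \<Sum>j<n. F i j *\<^sub>C (star (a i k) * a j l)) (star (e k) * e l))"
      by (simp add: clin_sum[OF Bl(2)] clin_scale[OF Bl(2)] scaleC_complex_def)
    also have "\<dots> = (\<Sum>k<n. \<Sum>l<n. F k l * B 1 (star (e k) * e l))"
      by (simp add: F(3) clin_scale[OF Bl(2)] scaleC_complex_def)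
    also have "\<dots> = B 1 W"
      by (simp add: W_def clin_sum[OF Bl(1)] clin_scale[OF Bl(1)] scaleC_complex_def)
    finally show "(\<Sum>(a, y)\<leftarrow>\<alpha> W. B a y) = (\<Sum>(a, y)\<leftarrow>[(1, W)]. B a y)"
      by (simp add: L_def)
  qed
  then have W: "W = \<mu> W *\<^sub>C 1" by (rule coinvariant_scalar)
  have "\<exists>y. W = (\<Sum>k<n. star (y k) * y k) \<and> e ` {..<n} \<subseteq> cvs.span (y ` {..<n})"
    unfolding W_def by (rule posdef_form_sum_of_squares) (use F(1,2) in blast)+
  then obtain y where y: "W = (\<Sum>k<n. star (y k) * y k)" "e ` {..<n} \<subseteq> cvs.span (y ` {..<n})" by blast
  have zy: "z \<in> cvs.span (y ` {..<n})"
    using z cvs.span_minimal[OF y(2) cvs.subspace_span] by blast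
  \<comment> \<open>The scalar is \<open>\<mu> W\<close>; positivity of \<open>\<mu>\<close> on each
    square makes it real and nonnegative.\<close>
  have "\<mu> W = (\<Sum>k<n. \<mu> (star (y k) * y k))" by (simp add: y(1) mu_sum)
  then have "Re (\<mu> W) \<ge> 0" "Im (\<mu> W) = 0"
    by (simp_all add: mu_real sum_nonneg mu_nonneg)
  then have "\<mu> W = complex_of_real (Re (\<mu> W))" by (simp add: complex_eq_iff)
  with W y(1) have "(\<Sum>k<n. star (y k) * y k) = scal (Re (\<mu> W))" by metis
  with \<open>Re (\<mu> W) \<ge> 0\<close> zy show ?thesis by (intro that)
qed

section \<open>Boundedness and faithfulness on the Galois extension\<close>

lemma bounded_elts_UNIV: "bounded_elts = UNIV"
proof -
  have "z \<in> bounded_elts" for z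
  proof -
    obtain n c and y :: "nat \<Rightarrow> 'z" where y: "(\<Sum>k<n. star (y k) * y k) = scal c"
      "z \<in> cvs.span (y ` {..<n})"
      by (rule invariant_sum_of_squares)
    have "y ` {..<n} \<subseteq> bounded_elts" using sum_star_self_bounded_elts[OF _ y(1)] by auto
    from cvs.span_minimal[OF this subspace_bounded_elts] show ?thesis using y(2) by blast
  qed
  then show ?thesis by blast
qed

text \<open>The bound on the \<open>y k\<close> involves only c and not the seminorm, and elements
  with a bound common to all C*-seminorms form a subspace, so z inherits one from the
  \<open>y k\<close>.\<close>

lemma cstar_seminorms_bounded: "bdd_above {p (z::'z) |p. cstar_seminorm p}"
proof -
  obtain n c and y :: "nat \<Rightarrow> 'z" where y: "c \<ge> 0" "(\<Sum>k<n. star (y k) * y k) = scal c"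
    "z \<in> cvs.span (y ` {..<n})"
    by (rule invariant_sum_of_squares)
  define V where "V = {z :: 'z. \<exists>K. \<forall>p. cstar_seminorm p \<longrightarrow> p z \<le> K}"
  have "cvs.subspace V"
  proof (rule cvs.subspaceI)
    show "0 \<in> V" unfolding V_def
      by (auto intro!: exI[of _ 0] dest!: cstar.intro simp: cstar.zero)
  next
    fix x y assume "x \<in> V" "y \<in> V"
    then obtain K L where "\<And>p. cstar_seminorm p \<Longrightarrow> p x \<le> K" "\<And>p. cstar_seminorm p \<Longrightarrow> p y \<le> L"
      by (auto simp: V_def)
    then have "p (x + y) \<le> K + L" if "cstar_seminorm p" for p
      using that cstar.add_le[OF cstar.intro[OF that], of x y] by (meson add_mono order_trans)
    then show "x + y \<in> V" unfolding V_def by blast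
  next
    fix d x assume "x \<in> V"
    then obtain K where K: "\<And>p. cstar_seminorm p \<Longrightarrow> p x \<le> K" by (auto simp: V_def)
    have "p (d *\<^sub>C x) \<le> cmod d * K" if "cstar_seminorm p" for p
      unfolding cstar.scale[OF cstar.intro[OF that]] using K[OF that] by (intro mult_left_mono) auto
    then show "d *\<^sub>C x \<in> V" unfolding V_def by blast
  qed
  moreover have "y k \<in> V" if "k < n" for k
  proof -
    have "p (y k) \<le> sqrt (2 * exp 2 * (c + 1))" if p: "cstar_seminorm p" for p
      using cstar.sum_star_self_bound[OF cstar.intro[OF p] _ y(2), of k] y(1) \<open>k < n\<close>
      by (simp add: real_le_rsqrt)
    then show ?thesis unfolding V_def by blast
  qed
  ultimately have "z \<in> V" using y(3) cvs.span_minimal[of "y ` {..<n}" V] by blast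
  then show ?thesis unfolding V_def by (auto simp: bdd_above_def)
qed

text \<open>The antipode moves the coaction from one factor to the other under \<open>\<mu>\<close>.\<close>

lemma strong_invariance:
  "(\<Sum>(a, w)\<leftarrow>\<alpha> z. \<mu> (y * w) *\<^sub>C a) = (\<Sum>(b, v)\<leftarrow>\<alpha> y. \<mu> (v * z) *\<^sub>C S b)"
proof -
  define T where "T v = (\<Sum>(a, w)\<leftarrow>\<alpha> z. \<mu> (v * w) *\<^sub>C a)" for v
  have T: "clin T" unfolding T_def case_prod_unfold
    by (intro clin_lists clin_smul_left clin_comp[OF clin_mu] clin_mult_right clin_id)
  have tri: "ctrilin (\<lambda>b b' v. S b * b' * T v)"
    by (intro ctrilinI clin_mult_left clin_mult_right clin_S clin_id T)
  \<comment> \<open>Invariance is read backwards: the scalar \<open>\<mu> (v * z)\<close> is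
    replaced by its coaction expansion. This produces a second leg of y next to \<open>S b\<close>,
    and the antipode identity then cancels both.\<close>
  have "(\<Sum>(b, v)\<leftarrow>\<alpha> y. \<mu> (v * z) *\<^sub>C S b) = (\<Sum>(b, v)\<leftarrow>\<alpha> y. S b * (\<Sum>(a, w)\<leftarrow>\<alpha> (v * z). \<mu> w *\<^sub>C a))"
    by (simp add: mu_invariant mult_scaleC_right)
  also have "\<dots> = (\<Sum>(b, v)\<leftarrow>\<alpha> y. S b * (\<Sum>(b', v')\<leftarrow>\<alpha> v. \<Sum>(a, w)\<leftarrow>\<alpha> z. \<mu> (v' * w) *\<^sub>C (b' * a)))"
    by (simp add: tensor_star_hom_mult[OF alpha_hom cbilin_scale'[OF clin_mu]])
  also have "\<dots> = (\<Sum>(b, v)\<leftarrow>\<alpha> y. \<Sum>(b', v')\<leftarrow>\<alpha> v. S b * b' * T v')"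
    by (simp add: T_def case_prod_unfold sum_list_const_mult[symmetric] mult_scaleC_right mult.assoc)
  also have "\<dots> = (\<Sum>(b, v)\<leftarrow>\<alpha> y. \<Sum>(p, q)\<leftarrow>\<Delta> b. S p * q * T v)"
    by (rule alpha_coassoc[OF tri, symmetric])
  also have "\<dots> = (\<Sum>(b, v)\<leftarrow>\<alpha> y. (\<Sum>(p, q)\<leftarrow>\<Delta> b. S p * q) * T v)"
    by (simp add: case_prod_unfold sum_list_mult_const)
  also have "\<dots> = (\<Sum>(b, v)\<leftarrow>\<alpha> y. \<epsilon> b *\<^sub>C T v)"
    by (simp add: antipode mult_scaleC_left)
  also have "\<dots> = T (\<Sum>(b, v)\<leftarrow>\<alpha> y. \<epsilon> b *\<^sub>C v)"
    by (simp add: clin_sum_list[OF T] case_prod_unfold clin_scale[OF T])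
  finally show ?thesis by (simp add: alpha_counit T_def)
qed

lemma mu_faithful:
  assumes "nrm z = 0"
  shows "z = 0"
proof -
  have null: "\<mu> (y * z) = 0" for y
    using Cauchy_Schwarz[of "star y" z] assms by (simp add: star_star)
  obtain es f where f: "\<And>e. clin (f e :: 'a \<Rightarrow> complex)"
    "teq (\<alpha> z) (map (\<lambda>e. (e, \<Sum>(a, w)\<leftarrow>\<alpha> z. f e a *\<^sub>C w)) es)"
    by (rule teq_expansion[of "\<alpha> z"]) blast
  define ze where "ze e = (\<Sum>(a, w)\<leftarrow>\<alpha> z. f e a *\<^sub>C w)" for e
  have ze: "\<mu> (y * ze e) = 0" for y e
  proof -
    have "\<mu> (y * ze e) = f e (\<Sum>(a, w)\<leftarrow>\<alpha> z. \<mu> (y * w) *\<^sub>C a)"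
      by (simp add: ze_def case_prod_unfold sum_list_const_mult[symmetric] clin_sum_list[OF clin_mu] mult_scaleC_right
          mu_scale clin_sum_list[OF f(1)] clin_scale[OF f(1)] scaleC_complex_def mult.commute)
    also have "\<dots> = 0" unfolding strong_invariance by (simp add: null case_prod_unfold clin_0[OF f(1)])
    finally show ?thesis .
  qed
  \<comment> \<open>A preimage of \<open>e \<otimes> 1\<close> for each first leg e. Multiplying its
    second legs on the right by \<open>ze e\<close> and adding up gives a preimage of
    \<open>\<alpha> z\<close>, whose other preimage is \<open>z \<otimes> 1\<close>. By injectivity
    they agree, and \<open>\<mu>\<close> kills every second leg \<open>q * ze e\<close>.\<close>
  have "\<forall>e. \<exists>s. teq (galois_map \<alpha> s) [(e, 1)]"
    using gal by (auto simp: star_galois_extension_def)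
  then obtain \<kappa> where k: "\<And>e. teq (galois_map \<alpha> (\<kappa> e)) [(e, 1)]" by metis
  define s where "s = concat (map (\<lambda>e. map (\<lambda>(p, q). (p, q * ze e)) (\<kappa> e)) es)"
  have "teq (galois_map \<alpha> s) (map (\<lambda>e. (e, ze e)) es)"
  proof (rule teqI)
    fix B :: "'a \<Rightarrow> 'z \<Rightarrow> complex" assume B: "cbilin B"
    from teq_cbilin[OF k cbilin_comp[OF B clin_id clin_mult_right[OF clin_id]]]
    have "(\<Sum>(p, q)\<leftarrow>\<kappa> e. \<Sum>(a, y)\<leftarrow>\<alpha> p. B a (y * q * ze e)) = B e (ze e)" for e
      by (simp add: galois_map_def sum_list_concat_map o_def case_prod_unfold)
    then show "(\<Sum>(a, y)\<leftarrow>galois_map \<alpha> s. B a y) = (\<Sum>(a, y)\<leftarrow>map (\<lambda>e. (e, ze e)) es. B a y)"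
      by (simp add: s_def galois_map_def sum_list_concat_map o_def case_prod_unfold mult.assoc)
  qed
  moreover have "teq (galois_map \<alpha> [(z, 1)]) (map (\<lambda>e. (e, ze e)) es)"
    using f(2) by (simp add: galois_map_def ze_def)
  ultimately have "teq [(z, 1)] s"
    using gal unfolding star_galois_extension_def by (meson teq_sym teq_trans)
  from teq_cbilin[OF this cbilin_scale'[OF clin_mu]]
  have "z = (\<Sum>(p, q)\<leftarrow>s. \<mu> q *\<^sub>C p)" by (simp add: mu_1 scaleC_one)
  also have "\<dots> = 0"
    by (simp add: s_def sum_list_concat_map o_def case_prod_unfold ze)
  finally show ?thesis .
qed

lemma opnorm_cstar_norm: "cstar_norm opnorm"
  unfolding cstar_norm_def
proof (intro conjI allI impI)
  show "cstar_seminorm opnorm" by (rule opnorm_cstar_seminorm[OF bounded_elts_UNIV])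
  fix x assume "opnorm x = 0"
  then have "nrm x \<le> 0"
    using opnorm_bound(1)[of x 1] bounded_elts_UNIV by simp
  then have "nrm x = 0" using nrm_nonneg[of x] by simp
  then show "x = 0" by (rule mu_faithful)
qed

end

section \<open>Suprema of C*-seminorms\<close>

lemma cstar_seminorm_SUP:
  fixes P :: "('z::star_alg \<Rightarrow> real) set"
  assumes "P \<noteq> {}" "\<And>p. p \<in> P \<Longrightarrow> cstar_seminorm p" "\<And>z. bdd_above ((\<lambda>p. p z) ` P)"
  shows "cstar_seminorm (\<lambda>z. SUP p\<in>P. p z)"
proof -
  have c: "cstar p" if "p \<in> P" for p using assms(2)[OF that] by (rule cstar.intro)
  define q where "q z = (SUP p\<in>P. p z)" for z
  have up: "p z \<le> q z" if "p \<in> P" for p z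
    unfolding q_def using that by (intro cSUP_upper assms(3))
  have least: "q z \<le> K" if "\<And>p. p \<in> P \<Longrightarrow> p z \<le> K" for z K
    unfolding q_def using that by (intro cSUP_least assms(1))
  have nn: "q z \<ge> 0" for z
    using assms(1) c cstar.nonneg up order_trans by (metis ex_in_conv)
  have "q (x + y) \<le> q x + q y" for x y
    using cstar.add_le[OF c] up by (intro least) (meson add_mono order_trans)
  moreover have "q (x * y) \<le> q x * q y" for x y
    using cstar.mult_le[OF c] up cstar.nonneg[OF c] nn by (intro least) (meson mult_mono order_trans)
  moreover have scale_le: "q (d *\<^sub>C x) \<le> cmod d * q x" for d x
  proof (rule least)
    fix p assume "p \<in> P"
    then show "p (d *\<^sub>C x) \<le> cmod d * q x"
      unfolding cstar.scale[OF c[OF \<open>p \<in> P\<close>]] by (intro mult_left_mono up) auto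
  qed
  have "q (d *\<^sub>C x) = cmod d * q x" for d x
  proof (cases "d = 0")
    case True
    then show ?thesis using scale_le[of d x] nn[of "d *\<^sub>C x"] by simp
  next
    case False
    then have "q x \<le> cmod (inverse d) * q (d *\<^sub>C x)"
      using scale_le[of "inverse d" "d *\<^sub>C x"] by (simp add: scaleC_scaleC scaleC_one)
    then have "cmod d * q x \<le> q (d *\<^sub>C x)"
      using False by (simp add: norm_divide inverse_eq_divide field_simps)
    with scale_le[of d x] show ?thesis by simp
  qed
  moreover have "q (star x * x) = (q x)\<^sup>2" for x
  proof (rule antisym)
    show "q (star x * x) \<le> (q x)\<^sup>2"
    proof (rule least)
      fix p assume p: "p \<in> P"
      show "p (star x * x) \<le> (q x)\<^sup>2"
        unfolding cstar.star_self[OF c[OF p]] by (intro power_mono up p cstar.nonneg[OF c[OF p]])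
    qed
    \<comment> \<open>The square root turns the C*-identity of each member into an upper bound for
      \<open>p x\<close> itself, so the supremum can be taken before squaring.\<close>
    have "q x \<le> sqrt (q (star x * x))"
    proof (rule least)
      fix p assume p: "p \<in> P"
      show "p x \<le> sqrt (q (star x * x))"
        using up[OF p, of "star x * x"] unfolding cstar.star_self[OF c[OF p]] by (rule real_le_rsqrt)
    qed
    then have "(q x)\<^sup>2 \<le> (sqrt (q (star x * x)))\<^sup>2" by (intro power_mono nn)
    then show "(q x)\<^sup>2 \<le> q (star x * x)" by (simp add: nn)
  qed
  ultimately show ?thesis unfolding cstar_seminorm_def q_def by blast
qed

theorem theorem5p2p1:
  fixes \<Delta> :: "'a::star_alg \<Rightarrow> ('a \<times> 'a) list" and \<epsilon> :: "'a \<Rightarrow> complex" and S :: "'a \<Rightarrow> 'a"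
    and \<alpha> :: "'z::star_alg \<Rightarrow> ('a \<times> 'z) list" and \<mu> :: "'z \<Rightarrow> complex"
  assumes "hopf_star_algebra \<Delta> \<epsilon> S"
    and "unitarizable \<Delta> \<epsilon>"
    and "star_galois_extension \<Delta> \<epsilon> \<alpha>"
    and "haar_measure \<alpha> \<mu>" and "positive_functional \<mu>"
  shows "(\<exists>p :: 'z \<Rightarrow> real. cstar_norm p) \<and>
         (\<forall>z. bdd_above {p z |p :: 'z \<Rightarrow> real. cstar_seminorm p}) \<and>
         cstar_norm (\<lambda>z. SUP p \<in> {p :: 'z \<Rightarrow> real. cstar_seminorm p}. p z)"
proof -
  interpret hopf_galois \<Delta> \<epsilon> S \<alpha> \<mu> using assms by unfold_locales
  let ?P = "{p :: 'z \<Rightarrow> real. cstar_seminorm p}"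
  have bdd: "bdd_above ((\<lambda>p. p z) ` ?P)" for z
    using cstar_seminorms_bounded[of z] by (simp add: image_Collect)
  \<comment> \<open>This membership serves twice: the family is nonempty, and its supremum dominates
    a norm and is therefore definite.\<close>
  have op: "opnorm \<in> ?P" using opnorm_cstar_norm by (simp add: cstar_norm_def)
  have "cstar_norm (\<lambda>z. SUP p \<in> ?P. p z)"
    unfolding cstar_norm_def
  proof (intro conjI allI impI)
    show "cstar_seminorm (\<lambda>z. SUP p \<in> ?P. p z)"
      by (rule cstar_seminorm_SUP) (use op in blast, simp, rule bdd)
    fix x assume "(SUP p \<in> ?P. p x) = 0"
    then have "opnorm x \<le> 0" using cSUP_upper[OF op bdd, of x] by simp
    moreover have "opnorm x \<ge> 0" using bounded_elts_UNIV by (intro opnorm_bound) simp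
    ultimately show "x = 0" using opnorm_cstar_norm by (simp add: cstar_norm_def)
  qed
  with opnorm_cstar_norm cstar_seminorms_bounded show ?thesis by blast
qed

end
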